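(* For any $n$-component link $L$ in $\mathbb{R}^3$, $$C(L)\le 2g(L)+1.$$
   Context: Links are unoriented. A spanning surface of a link $L$ is a connected compact surface embedded in $\mathbb{R}^3$ with boundary $L$. For an $n$-component link $L$, $C(L)$ is the minimum of $2-\chi(\Sigma)-n$ over all connected non-orientable spanning surfaces $\Sigma$ of $L$, where $\chi$ is the Euler characteristic, and $g(L)$ (the orientable genus) is the minimal genus of a connected orientable spanning surface of $L$, so that a surface realizing it has Euler characteristic $2-2g(L)-n$. *)

theory Defs
  imports "HOL-Analysis.Analysis" "HOL-Library.Extended_Nat"
begin

(* Everything is tame, as usual in knot theory: links and surfaces are the images of
   polyhedra under homeomorphisms of the whole of R^3. This covers polygonal and smooth
   links and surfaces, and excludes wild ones. *)

definition is_link :: "nat \<Rightarrow> (real^3) set \<Rightarrow> bool" where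
  "is_link n L \<longleftrightarrow>
     n \<ge> 1 \<and> card (components L) = n \<and>
     (\<forall>C \<in> components L. C homeomorphic sphere (0 :: real^2) 1) \<and>
     (\<exists>h k K. homeomorphism UNIV UNIV h k \<and> simplicial_complex K \<and>
        (L :: (real^3) set) = h ` \<Union>(K :: (real^3) set set))"

definition triangles :: "'a::euclidean_space set set \<Rightarrow> 'a set set" where
  "triangles K = {T \<in> K. 2 simplex T}"

definition edges :: "'a::euclidean_space set set \<Rightarrow> 'a set set" where
  "edges K = {E \<in> K. 1 simplex E}"

definition vertices :: "'a::euclidean_space set set \<Rightarrow> 'a set set" where
  "vertices K = {V \<in> K. 0 simplex V}"

definition triangles_at :: "'a::euclidean_space set set \<Rightarrow> 'a set \<Rightarrow> 'a set set" where
  "triangles_at K E = {T \<in> triangles K. E \<subseteq> T}"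

definition vertex_link :: "'a::euclidean_space set set \<Rightarrow> 'a \<Rightarrow> 'a set" where
  "vertex_link K v = \<Union>{S \<in> K. v \<notin> S \<and> (\<exists>T \<in> K. v \<in> T \<and> S \<subseteq> T)}"

(* Triangulated compact surface with (possibly empty) boundary. By the condition on edges,
   a vertex link is a graph with all degrees 1 or 2; being connected, it is an arc
   (boundary vertex) or a circle (interior vertex). *)
definition triangulated_surface :: "'a::euclidean_space set set \<Rightarrow> bool" where
  "triangulated_surface K \<longleftrightarrow>
     simplicial_complex K \<and>
     (\<forall>S \<in> K. \<exists>T \<in> triangles K. S \<subseteq> T) \<and>
     (\<forall>E \<in> edges K. card (triangles_at K E) \<in> {1, 2}) \<and>
     (\<forall>v. {v} \<in> K \<longrightarrow> connected (vertex_link K v))"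

definition surface_boundary :: "'a::euclidean_space set set \<Rightarrow> 'a set" where
  "surface_boundary K = \<Union>{E \<in> edges K. card (triangles_at K E) = 1}"

definition euler_char :: "'a::euclidean_space set set \<Rightarrow> int" where
  "euler_char K = int (card (vertices K)) - int (card (edges K)) + int (card (triangles K))"

(* The two orientations of a triangle, each given by the directed edges it induces. *)
definition triangle_orientations :: "'a::euclidean_space set \<Rightarrow> ('a \<times> 'a) set set" where
  "triangle_orientations T =
     {{(a, b), (b, c), (c, a)} | a b c. card {a, b, c} = 3 \<and> T = convex hull {a, b, c}}"

(* Coherent orientation: triangles with a common edge induce opposite directions on it. *)
definition orientable :: "'a::euclidean_space set set \<Rightarrow> bool" where
  "orientable K \<longleftrightarrow>
     (\<exists>or. (\<forall>T \<in> triangles K. or T \<in> triangle_orientations T) \<and>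
           (\<forall>T \<in> triangles K. \<forall>T' \<in> triangles K. T \<noteq> T' \<longrightarrow> or T \<inter> or T' = {}))"

(* The surface is h ` \<Union>K. It is handled through the triangulation K, because orientability
   and Euler characteristic are read off from K; neither depends on the choice of K. *)
definition spanning_surface ::
    "(real^3) set \<Rightarrow> (real^3 \<Rightarrow> real^3) \<Rightarrow> (real^3) set set \<Rightarrow> bool" where
  "spanning_surface L h K \<longleftrightarrow>
     triangulated_surface K \<and> connected (\<Union>K) \<and>
     (\<exists>k. homeomorphism UNIV UNIV h k) \<and> h ` surface_boundary K = L"

(* Both minima are taken in the extended naturals, where the minimum of the empty set would
   be infinity; for a link neither set is empty, by Seifert's theorem. By the classification
   of surfaces the integers 2 - euler_char K - n are nonnegative, and even if K is orientable,
   so that asking for c and g to be natural numbers leaves out no surface. *)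
definition crosscap_number :: "(real^3) set \<Rightarrow> enat" where
  "crosscap_number L =
     (INF c \<in> {c. \<exists>h K. spanning_surface L h K \<and> \<not> orientable K \<and>
                  int c = 2 - euler_char K - int (card (components L))}. enat c)"

definition orientable_genus :: "(real^3) set \<Rightarrow> enat" where
  "orientable_genus L =
     (INF g \<in> {g. \<exists>h K. spanning_surface L h K \<and> orientable K \<and>
                  euler_char K = 2 - 2 * int g - int (card (components L))}. enat g)"

end

theory Submission imports Defs begin

text \<open>Let \<open>abc\<close> be the triangle at a boundary edge \<open>ab\<close> of an orientable surface of minimal genus.
  It is replaced by a Moebius band with the same boundary: the six-vertex projective plane without
  the triangle \<open>abc\<close>, with its three further vertices \<open>d\<close>, \<open>e\<close>, \<open>f\<close> placed close to the midpoint of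
  \<open>ab\<close> so that the triangle \<open>def\<close> encircles \<open>ab\<close>. The boundary stays the same point set, the Euler
  characteristic drops by one, and the result is not orientable. No other simplex is hit, because
  each simplex of the complex apart from \<open>abc\<close> and \<open>ab\<close> is separated from \<open>abc\<close> by a hyperplane that
  has the midpoint of \<open>ab\<close> strictly on the side of \<open>abc\<close>.\<close>

section \<open>Geometric realization of simplicial complexes\<close>

text \<open>The homeomorphism of space stays fixed and only the complex changes, so the boundary has
  to survive as the very same point set; hence the exchange of a triangle for a band with the same
  boundary. The core \<open>def\<close> of a Moebius band has odd linking number with the boundary
  \<open>abc\<close>, so it must wind around an edge of \<open>abc\<close>. Close to an interior
  edge it would run into the second triangle there; the midpoint of a boundary edge lies in no
  simplex other than \<open>abc\<close> and \<open>ab\<close>. The band is not confined to a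
  neighbourhood of that midpoint, since some of its triangles reach \<open>c\<close>, and other
  simplices may touch \<open>abc\<close> along its remaining edges and vertices, so distance
  estimates do not suffice. Weak separation from \<open>abc\<close> that is strict at the midpoint
  does: once \<open>d\<close>, \<open>e\<close>, \<open>f\<close> are strictly on the side of
  \<open>abc\<close>, a point of the band in the opposite closed half-space gives them no weight and
  so lies in \<open>abc\<close>.\<close>

lemma mem_convex_hull_image_iff:
  fixes p :: "'v::finite \<Rightarrow> 'a::real_vector"
  shows "x \<in> convex hull (p ` \<sigma>) \<longleftrightarrow>
    (\<exists>w. (\<forall>i. 0 \<le> w i) \<and> (\<forall>i. i \<notin> \<sigma> \<longrightarrow> w i = 0) \<and> sum w UNIV = 1 \<and> (\<Sum>i\<in>UNIV. w i *\<^sub>R p i) = x)"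
    (is "_ \<longleftrightarrow> (\<exists>w. ?P w x)")
proof
  have "convex {x. \<exists>w. ?P w x}"
  proof (rule convexI, clarify)
    fix w1 w2 :: "'v \<Rightarrow> real" and s t :: real
    assume st: "0 \<le> s" "0 \<le> t" "s + t = 1"
      and w: "\<forall>i. 0 \<le> w1 i" "\<forall>i. i \<notin> \<sigma> \<longrightarrow> w1 i = 0" "sum w1 UNIV = 1"
        "\<forall>i. 0 \<le> w2 i" "\<forall>i. i \<notin> \<sigma> \<longrightarrow> w2 i = 0" "sum w2 UNIV = 1"
    show "\<exists>w. ?P w (s *\<^sub>R (\<Sum>i\<in>UNIV. w1 i *\<^sub>R p i) + t *\<^sub>R (\<Sum>i\<in>UNIV. w2 i *\<^sub>R p i))"
      using st w
      by (intro exI[of _ "\<lambda>i. s * w1 i + t * w2 i"])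
        (simp add: sum.distrib scaleR_sum_right algebra_simps flip: sum_distrib_left)
  qed
  moreover have "p ` \<sigma> \<subseteq> {x. \<exists>w. ?P w x}"
  proof clarify
    fix j assume "j \<in> \<sigma>"
    then show "\<exists>w. ?P w (p j)"
      by (intro exI[of _ "\<lambda>i. if i = j then 1 else 0"]) (auto simp: if_distrib[of "\<lambda>c. c *\<^sub>R _"] cong: if_cong)
  qed
  ultimately show "\<exists>w. ?P w x" if "x \<in> convex hull (p ` \<sigma>)"
    using that hull_minimal[of "p ` \<sigma>" "{x. \<exists>w. ?P w x}" convex] by auto
next
  assume "\<exists>w. ?P w x"
  then obtain w where w: "?P w x" by blast
  have "(\<Sum>i\<in>\<sigma>. w i *\<^sub>R p i) = x" "sum w \<sigma> = 1"
    using w by (auto intro!: sum.mono_neutral_cong_left simp flip: w[THEN conjunct2, THEN conjunct2, THEN conjunct1] w[THEN conjunct2, THEN conjunct2, THEN conjunct2])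
  moreover have "(\<Sum>i\<in>\<sigma>. w i *\<^sub>R p i) \<in> convex hull (p ` \<sigma>)"
    using w \<open>sum w \<sigma> = 1\<close> by (intro convex_sum) (auto intro: hull_inc)
  ultimately show "x \<in> convex hull (p ` \<sigma>)" by simp
qed

text \<open>The last hypothesis says that the signs of an affine dependency are never carried by two
  faces: such a pair of faces would intersect outside their common vertices.\<close>

locale realization =
  fixes p :: "'v::finite \<Rightarrow> 'a::euclidean_space" and \<Delta> :: "'v set set"
  assumes subface: "\<sigma> \<in> \<Delta> \<Longrightarrow> \<tau> \<subseteq> \<sigma> \<Longrightarrow> \<tau> \<in> \<Delta>"
    and singleton_face: "{i} \<in> \<Delta>"
    and no_sign_pair: "sum w UNIV = 0 \<Longrightarrow> (\<Sum>i\<in>UNIV. w i *\<^sub>R p i) = 0 \<Longrightarrow>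
      {i. 0 < w i} \<in> \<Delta> \<Longrightarrow> {i. w i < 0} \<in> \<Delta> \<Longrightarrow> w i = 0"
begin

definition cell :: "'v set \<Rightarrow> 'a set" where "cell \<sigma> = convex hull (p ` \<sigma>)"

text \<open>If two vertices coincided, the difference of their indicator functions would be a
  dependency whose sign sets are singletons, hence faces.\<close>

lemma inj_p: "inj p"
proof (rule injI, rule ccontr)
  fix i j assume "p i = p j" "i \<noteq> j"
  define w :: "'v \<Rightarrow> real" where "w = (\<lambda>k. (if k = i then 1 else 0) - (if k = j then 1 else 0))"
  have "sum w UNIV = 0" "(\<Sum>k\<in>UNIV. w k *\<^sub>R p k) = 0"
    using \<open>p i = p j\<close> by (auto simp: w_def sum_subtractf scaleR_left_diff_distrib
        if_distrib[of "\<lambda>c. c *\<^sub>R _"] cong: if_cong)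
  moreover have "{k. 0 < w k} = {i}" "{k. w k < 0} = {j}"
    using \<open>i \<noteq> j\<close> by (auto simp: w_def split: if_splits)
  ultimately have "w i = 0" using no_sign_pair singleton_face by metis
  then show False using \<open>i \<noteq> j\<close> by (simp add: w_def)
qed

text \<open>Weights are functions on all vertices, so the weights \<open>u\<close> over \<sigma> and
  \<open>v\<close> over \<tau> of a common point can be subtracted. The positive part of
  \<open>u - v\<close> is carried by \<sigma> and the negative part by \<tau>, which forces
  \<open>u = v\<close>, supported in both faces.\<close>

lemma cell_Int:
  assumes "\<sigma> \<in> \<Delta>" "\<tau> \<in> \<Delta>"
  shows "cell \<sigma> \<inter> cell \<tau> = cell (\<sigma> \<inter> \<tau>)"
proof
  show "cell \<sigma> \<inter> cell \<tau> \<subseteq> cell (\<sigma> \<inter> \<tau>)"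
  proof clarify
    fix x assume "x \<in> cell \<sigma>" "x \<in> cell \<tau>"
    then obtain u v :: "'v \<Rightarrow> real" where u: "\<forall>i. 0 \<le> u i" "\<forall>i. i \<notin> \<sigma> \<longrightarrow> u i = 0" "sum u UNIV = 1"
        "(\<Sum>i\<in>UNIV. u i *\<^sub>R p i) = x"
      and v: "\<forall>i. 0 \<le> v i" "\<forall>i. i \<notin> \<tau> \<longrightarrow> v i = 0" "sum v UNIV = 1"
        "(\<Sum>i\<in>UNIV. v i *\<^sub>R p i) = x"
      unfolding cell_def mem_convex_hull_image_iff by blast
    have "i \<in> \<sigma>" if "0 < u i - v i" for i
      using u(2) spec[OF v(1), of i] that by (cases "i \<in> \<sigma>") auto
    then have "{i. 0 < u i - v i} \<subseteq> \<sigma>" by blast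
    moreover have "i \<in> \<tau>" if "u i - v i < 0" for i
      using v(2) spec[OF u(1), of i] that by (cases "i \<in> \<tau>") auto
    then have "{i. u i - v i < 0} \<subseteq> \<tau>" by blast
    ultimately have "{i. 0 < u i - v i} \<in> \<Delta>" "{i. u i - v i < 0} \<in> \<Delta>"
      using assms subface by blast+
    then have "u i - v i = 0" for i
      using u(3,4) v(3,4) by (intro no_sign_pair[of "\<lambda>i. u i - v i"])
        (simp_all add: sum_subtractf scaleR_left_diff_distrib)
    then have "u i = 0" if "i \<notin> \<sigma> \<inter> \<tau>" for i using u(2) v(2) that by (metis IntI diff_0_right diff_0 neg_equal_0_iff_equal)
    then show "x \<in> cell (\<sigma> \<inter> \<tau>)"
      unfolding cell_def mem_convex_hull_image_iff using u by blast
  qed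
  show "cell (\<sigma> \<inter> \<tau>) \<subseteq> cell \<sigma> \<inter> cell \<tau>"
    unfolding cell_def by (simp add: hull_mono image_mono)
qed

lemma cell_mono: "\<sigma> \<subseteq> \<tau> \<Longrightarrow> cell \<sigma> \<subseteq> cell \<tau>"
  unfolding cell_def by (simp add: hull_mono image_mono)

lemma cell_empty [simp]: "cell {} = {}" and cell_singleton [simp]: "cell {i} = {p i}"
  and cell_eq_empty [simp]: "cell \<sigma> = {} \<longleftrightarrow> \<sigma> = {}"
  by (simp_all add: cell_def)

lemma vertex_in_cell: "i \<in> \<sigma> \<Longrightarrow> p i \<in> cell \<sigma>"
  by (simp add: cell_def hull_inc)

lemma vertex_in_cell_iff:
  assumes "\<sigma> \<in> \<Delta>" shows "p i \<in> cell \<sigma> \<longleftrightarrow> i \<in> \<sigma>"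
  using cell_Int[OF singleton_face assms, of i] vertex_in_cell by (cases "i \<in> \<sigma>") auto

lemma cell_subset_iff:
  assumes "\<tau> \<in> \<Delta>" shows "cell \<sigma> \<subseteq> cell \<tau> \<longleftrightarrow> \<sigma> \<subseteq> \<tau>"
proof
  assume "cell \<sigma> \<subseteq> cell \<tau>"
  then show "\<sigma> \<subseteq> \<tau>" using vertex_in_cell vertex_in_cell_iff[OF assms] by blast
qed (rule cell_mono)

lemma inj_on_cell: "inj_on cell \<Delta>"
proof (rule inj_onI)
  fix \<sigma> \<tau> assume "\<sigma> \<in> \<Delta>" "\<tau> \<in> \<Delta>" "cell \<sigma> = cell \<tau>"
  then show "\<sigma> = \<tau>" using cell_subset_iff[of \<sigma> \<tau>] cell_subset_iff[of \<tau> \<sigma>] by simp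
qed

text \<open>A dependency among the vertices of one face has both sign sets inside that face.\<close>

lemma affine_independent_vertices:
  assumes "\<sigma> \<in> \<Delta>" shows "\<not> affine_dependent (p ` \<sigma>)"
proof
  assume "affine_dependent (p ` \<sigma>)"
  then obtain U where U: "sum U (p ` \<sigma>) = 0" "\<exists>x\<in>p ` \<sigma>. U x \<noteq> 0" "(\<Sum>x\<in>p ` \<sigma>. U x *\<^sub>R x) = 0"
    by (subst (asm) affine_dependent_explicit_finite) auto
  define w where "w = (\<lambda>i. if i \<in> \<sigma> then U (p i) else 0)"
  have "sum w UNIV = sum U (p ` \<sigma>)"
    by (simp add: w_def sum.reindex inj_on_subset[OF inj_p] flip: sum.inter_filter)
  moreover have "(\<Sum>i\<in>UNIV. w i *\<^sub>R p i) = (\<Sum>x\<in>p ` \<sigma>. U x *\<^sub>R x)"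
    by (simp add: w_def sum.reindex inj_on_subset[OF inj_p] if_distrib[of "\<lambda>c. c *\<^sub>R _"] 
        cong: if_cong flip: sum.inter_filter)
  moreover have "{i. 0 < w i} \<in> \<Delta>" "{i. w i < 0} \<in> \<Delta>"
    by (auto intro!: subface[OF assms] simp: w_def split: if_splits)
  ultimately have "\<And>i. w i = 0" using U no_sign_pair by auto
  then show False using U(2) by (force simp: w_def split: if_splits)
qed

lemma card_vertices: "card (p ` \<sigma>) = card \<sigma>"
  by (simp add: card_image inj_on_subset[OF inj_p])

lemma simplex_cell_iff:
  assumes "\<sigma> \<in> \<Delta>" shows "n simplex cell \<sigma> \<longleftrightarrow> int (card \<sigma>) = n + 1"
proof
  assume "n simplex cell \<sigma>"
  then show "int (card \<sigma>) = n + 1"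
    using aff_dim_simplex affine_independent_vertices[OF assms] aff_dim_convex_hull
      aff_dim_affine_independent card_vertices unfolding cell_def by metis
next
  assume "int (card \<sigma>) = n + 1"
  then show "n simplex cell \<sigma>"
    unfolding cell_def using affine_independent_vertices[OF assms] card_vertices
    by (intro simplex_convex_hull) auto
qed

lemma face_of_cell_iff:
  assumes "\<sigma> \<in> \<Delta>" shows "F face_of cell \<sigma> \<longleftrightarrow> (\<exists>\<tau>\<subseteq>\<sigma>. F = cell \<tau>)"
  unfolding cell_def face_of_convex_hull_affine_independent[OF affine_independent_vertices[OF assms]]
  by (metis subset_image_iff)

end

section \<open>The Moebius band\<close>

datatype vtx = Va | Vb | Vc | Vd | Ve | Vf

lemma UNIV_vtx: "UNIV = {Va, Vb, Vc, Vd, Ve, Vf}"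
  using vtx.exhaust by auto

instance vtx :: finite
  by standard (simp add: UNIV_vtx)

text \<open>The six-vertex triangulation of the projective plane without the triangle \<open>outer\<close>:
  a Moebius band whose boundary is the boundary of that triangle.\<close>

definition band_triangles :: "vtx set set" where
  "band_triangles = {{Va, Vb, Vd}, {Vb, Vc, Ve}, {Vc, Va, Vf}, {Va, Vd, Ve}, {Vb, Ve, Vf},
     {Vc, Vf, Vd}, {Va, Ve, Vf}, {Vb, Vf, Vd}, {Vc, Vd, Ve}}"

definition band_faces :: "vtx set set" where
  "band_faces = \<Union>(Pow ` band_triangles)"

definition outer :: "vtx set" where
  "outer = {Va, Vb, Vc}"

lemma outer_not_band_face: "outer \<notin> band_faces"
  by (simp add: outer_def band_faces_def band_triangles_def)

lemma band_faces_subface: "\<sigma> \<in> band_faces \<Longrightarrow> \<tau> \<subseteq> \<sigma> \<Longrightarrow> \<tau> \<in> band_faces"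
  by (auto simp: band_faces_def)

lemma band_triangle_face: "\<tau> \<in> band_triangles \<Longrightarrow> \<tau> \<in> band_faces"
  by (auto simp: band_faces_def)

lemma band_face_subset: "\<sigma> \<in> band_faces \<Longrightarrow> \<exists>\<tau>\<in>band_triangles. \<sigma> \<subseteq> \<tau>"
  by (auto simp: band_faces_def)

lemma subset_outer_face:
  assumes "\<sigma> \<subset> outer" shows "\<sigma> \<in> band_faces"
proof -
  have "\<sigma> \<subseteq> {Va, Vb} \<or> \<sigma> \<subseteq> {Vb, Vc} \<or> \<sigma> \<subseteq> {Vc, Va}"
    using assms by (auto simp: outer_def)
  moreover have "{Va, Vb} \<in> band_faces" "{Vb, Vc} \<in> band_faces" "{Vc, Va} \<in> band_faces"
    by (simp_all add: band_faces_def band_triangles_def)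
  ultimately show ?thesis using band_faces_subface by blast
qed

text \<open>Proper faces of \<open>outer\<close> are already present in the complex to be patched;
  only faces reaching outside \<open>outer\<close> count as new.\<close>

lemma inner_vertices: "{\<sigma> \<in> band_faces. \<not> \<sigma> \<subseteq> outer \<and> card \<sigma> = 1} = {{Vd}, {Ve}, {Vf}}"
  (is "?L = ?R")
proof
  show "?L \<subseteq> ?R"
  proof (rule subsetI)
    fix \<sigma> assume "\<sigma> \<in> ?L"
    then obtain i where "\<sigma> = {i}" "\<not> \<sigma> \<subseteq> outer" by (auto simp: card_1_singleton_iff)
    then show "\<sigma> \<in> ?R" by (cases i) (simp_all add: outer_def)
  qed
  show "?R \<subseteq> ?L"
    by (simp add: band_faces_def band_triangles_def outer_def)
qed

text \<open>The triangulation is 2-neighborly: all 15 pairs of vertices are edges, and without the 3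
  edges of \<open>outer\<close> these 12 remain.\<close>

definition inner_edges :: "vtx set set" where
  "inner_edges = {{Va, Vd}, {Va, Ve}, {Va, Vf}, {Vb, Vd}, {Vb, Ve}, {Vb, Vf},
     {Vc, Vd}, {Vc, Ve}, {Vc, Vf}, {Vd, Ve}, {Vd, Vf}, {Ve, Vf}}"

lemma inner_edges: "{\<sigma> \<in> band_faces. \<not> \<sigma> \<subseteq> outer \<and> card \<sigma> = 2} = inner_edges"
  (is "?L = ?R")
proof
  show "?L \<subseteq> ?R"
  proof (rule subsetI)
    fix \<sigma> assume "\<sigma> \<in> ?L"
    then obtain i j where "\<sigma> = {i, j}" "i \<noteq> j" "\<not> \<sigma> \<subseteq> outer" by (auto simp: card_2_iff)
    then show "\<sigma> \<in> inner_edges"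
      by (cases i; cases j) (simp_all add: outer_def inner_edges_def doubleton_eq_iff)
  qed
  show "?R \<subseteq> ?L"
    by (simp add: band_faces_def band_triangles_def outer_def inner_edges_def)
qed

lemma inner_triangles: "{\<sigma> \<in> band_faces. \<not> \<sigma> \<subseteq> outer \<and> card \<sigma> = 3} = band_triangles"
  (is "?L = ?R")
proof
  have *: "\<forall>\<sigma>\<in>band_triangles. \<not> \<sigma> \<subseteq> outer \<and> card \<sigma> = 3"
    by (simp add: band_triangles_def outer_def)
  show "?L \<subseteq> ?R"
  proof (rule subsetI)
    fix \<sigma> assume \<sigma>: "\<sigma> \<in> ?L"
    then obtain \<tau> where "\<tau> \<in> band_triangles" "\<sigma> \<subseteq> \<tau>" using band_face_subset by blast
    then show "\<sigma> \<in> band_triangles"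
      using \<sigma> * card_subset_eq[of \<tau> \<sigma>] by simp
  qed
  show "?R \<subseteq> ?L"
    using * band_triangle_face by blast
qed

lemma card_inner_edges: "card inner_edges = 12"
  by (simp add: inner_edges_def doubleton_eq_iff)

text \<open>Reduces equality of listed triples to memberships, which simplification decides; this is
  how the nine triangles are seen to be distinct.\<close>

lemma band_triangle_eq_iff:
  "{a, b, c} = {a', b', c'} \<longleftrightarrow> {a, b, c} \<subseteq> {a', b', c'} \<and> {a', b', c'} \<subseteq> {a, b, c}"
  for a b c a' b' c' :: vtx
  by blast

lemma sum_band_triangles:
  "(\<Sum>\<tau>\<in>band_triangles. f \<tau>) = f {Va, Vb, Vd} + f {Vb, Vc, Ve} + f {Vc, Va, Vf} + f {Va, Vd, Ve} +
     f {Vb, Ve, Vf} + f {Vc, Vf, Vd} + f {Va, Ve, Vf} + f {Vb, Vf, Vd} + f {Vc, Vd, Ve}"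
  for f :: "vtx set \<Rightarrow> nat"
  by (simp add: band_triangles_def band_triangle_eq_iff)

lemma card_band_triangles: "card band_triangles = 9"
  using sum_band_triangles[of "\<lambda>_. 1"] by simp

text \<open>Incidence numbers become sums of nine indicators, which can be evaluated edge by
  edge.\<close>

lemma card_filter_band_triangles:
  "card {\<tau> \<in> band_triangles. P \<tau>} = (\<Sum>\<tau>\<in>band_triangles. if P \<tau> then 1 else 0)"
  by (simp flip: sum.inter_filter)

lemma triangles_at_inner_edge:
  assumes "\<sigma> \<in> inner_edges" shows "card {\<tau> \<in> band_triangles. \<sigma> \<subseteq> \<tau>} = 2"
proof -
  have "\<forall>\<sigma>\<in>inner_edges. card {\<tau> \<in> band_triangles. \<sigma> \<subseteq> \<tau>} = 2"
    unfolding card_filter_band_triangles sum_band_triangles by (simp add: inner_edges_def)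
  then show ?thesis using assms by blast
qed

lemma triangles_at_outer_edge:
  assumes "\<sigma> \<subseteq> outer" "card \<sigma> = 2" shows "card {\<tau> \<in> band_triangles. \<sigma> \<subseteq> \<tau>} = 1"
proof -
  have "\<forall>\<sigma>\<in>Pow outer. card \<sigma> = 2 \<longrightarrow> card {\<tau> \<in> band_triangles. \<sigma> \<subseteq> \<tau>} = 1"
    unfolding card_filter_band_triangles sum_band_triangles by (simp add: outer_def Pow_insert)
  then show ?thesis using assms by blast
qed

text \<open>In a separation of \<open>Y \<union> M\<close> the connected set \<open>M\<close> lies
  on one side. Since \<open>Y \<inter> T\<close> is part of \<open>M\<close>, putting
  \<open>T\<close> on that side in place of \<open>M\<close> separates \<open>Y \<union> T\<close>.
  This serves both for the whole surface and for vertex links.\<close>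

lemma connected_Un_exchange:
  fixes Y T M :: "'a::topological_space set"
  assumes "connected (Y \<union> T)" "closed Y" "closed T" "connected M" "closed M"
    and "T \<noteq> {}" "M \<noteq> {}" "Y \<inter> T \<subseteq> M"
  shows "connected (Y \<union> M)"
  unfolding connected_closed
proof (rule notI, elim exE conjE)
  fix A B assume AB: "closed A" "closed B" "Y \<union> M \<subseteq> A \<union> B" "A \<inter> B \<inter> (Y \<union> M) = {}"
    "A \<inter> (Y \<union> M) \<noteq> {}" "B \<inter> (Y \<union> M) \<noteq> {}"
  have *: False if "closed A" "closed B" "Y \<union> M \<subseteq> A \<union> B" "A \<inter> B \<inter> (Y \<union> M) = {}"
    "M \<subseteq> A" "B \<inter> (Y \<union> M) \<noteq> {}" for A B
  proof -
    have "closed ((A \<inter> Y) \<union> T)" "closed (B \<inter> Y)" using that assms by auto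
    moreover have "((A \<inter> Y) \<union> T) \<inter> (B \<inter> Y) = {}" using that assms(8) by blast
    moreover have "Y \<union> T \<subseteq> ((A \<inter> Y) \<union> T) \<union> (B \<inter> Y)" using that by blast
    moreover have "B \<inter> Y \<noteq> {}" using that by blast
    ultimately show False
      using assms(1,6) unfolding connected_closed by blast
  qed
  have "M \<subseteq> A \<or> M \<subseteq> B"
    using assms(4) AB unfolding connected_closed by blast
  then show False
    using *[of A B] *[of B A] AB by (auto simp: Int_commute Un_commute)
qed

section \<open>Replacing a triangle by the band\<close>

lemma simplex_dim_unique: "n simplex S \<Longrightarrow> m simplex S \<Longrightarrow> n = m"
  by (metis aff_dim_simplex)

text \<open>\<open>near\<close> is what keeps the new cells off the rest of the complex: any contact
  takes place inside the old triangle, where the face structure is known. \<open>new_vertex\<close>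
  ensures that no new cell lies in an old simplex.\<close>

locale band_patch = realization p band_faces for p :: "vtx \<Rightarrow> 'a::euclidean_space" +
  fixes K :: "'a set set"
  assumes surface: "triangulated_surface K"
    and outer_triangle: "cell outer \<in> triangles K"
    and new_vertex: "i \<notin> outer \<Longrightarrow> p i \<notin> \<Union>K"
    and near: "S \<in> K \<Longrightarrow> S \<noteq> cell outer \<Longrightarrow> \<sigma> \<in> band_faces \<Longrightarrow> cell \<sigma> \<inter> S \<subseteq> cell outer"
begin

definition patched :: "'a set set" where
  "patched = (K - {cell outer}) \<union> cell ` band_faces"

text \<open>Leaving out the faces inside \<open>outer\<close>, which belong to \<open>K\<close> as
  well, makes the union in \<open>patched_eq\<close> disjoint, as counting requires.\<close>

definition new_cells :: "'a set set" where
  "new_cells = cell ` {\<sigma> \<in> band_faces. \<not> \<sigma> \<subseteq> outer}"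

section \<open>Intersections of old simplices with new cells\<close>

lemma complex: "simplicial_complex K"
  using surface by (simp add: triangulated_surface_def)

lemma complex_face: "S \<in> K \<Longrightarrow> F face_of S \<Longrightarrow> F \<in> K"
  and complex_Int: "S \<in> K \<Longrightarrow> S' \<in> K \<Longrightarrow> (S \<inter> S') face_of S"
  and complex_simplex: "S \<in> K \<Longrightarrow> \<exists>n. n simplex S"
  and finite_complex: "finite K"
  using complex unfolding simplicial_complex_def by blast+

lemma in_triangle: "S \<in> K \<Longrightarrow> \<exists>T\<in>triangles K. S \<subseteq> T"
  using surface by (simp add: triangulated_surface_def)

lemma outer_in_K: "cell outer \<in> K" and outer_simplex: "2 simplex cell outer"
  using outer_triangle by (auto simp: triangles_def)

text \<open>\<open>outer\<close> is not a band face, so the realization says nothing about it;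
  independence comes from three points spanning dimension 2.\<close>

lemma outer_independent: "\<not> affine_dependent (p ` outer)"
proof -
  have "aff_dim (p ` outer) = 2"
    using aff_dim_simplex[OF outer_simplex] by (simp add: cell_def aff_dim_convex_hull)
  then show ?thesis
    by (simp add: affine_independent_iff_card card_vertices) (simp add: outer_def)
qed

lemma face_of_outer_iff: "F face_of cell outer \<longleftrightarrow> (\<exists>\<tau>\<subseteq>outer. F = cell \<tau>)"
  unfolding cell_def face_of_convex_hull_affine_independent[OF outer_independent]
  by (metis subset_image_iff)

lemma proper_face_of_outer:
  assumes "F face_of cell outer" "F \<noteq> cell outer"
  obtains \<tau> where "\<tau> \<subset> outer" "F = cell \<tau>"
  using assms face_of_outer_iff by auto

lemma outer_not_subset_cell:
  assumes "\<sigma> \<in> band_faces" shows "\<not> cell outer \<subseteq> cell \<sigma>"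
  unfolding cell_subset_iff[OF assms] using assms outer_not_band_face band_faces_subface by blast

lemma outer_face_in_K:
  assumes "\<tau> \<subset> outer" shows "cell \<tau> \<in> K - {cell outer}"
proof -
  have "cell \<tau> \<in> K"
    using assms face_of_outer_iff complex_face outer_in_K by blast
  then show ?thesis
    using outer_not_subset_cell[OF subset_outer_face[OF assms]] by auto
qed

text \<open>A triangle containing \<open>S\<close> would have \<open>cell outer\<close> as a face of
  its own dimension, hence equal to it.\<close>

lemma outer_maximal:
  assumes "S \<in> K" "cell outer \<subseteq> S" shows "S = cell outer"
proof -
  obtain T where T: "T \<in> K" "2 simplex T" "S \<subseteq> T"
    using in_triangle[OF assms(1)] by (auto simp: triangles_def)
  have "cell outer face_of T"
    using complex_Int[OF T(1) outer_in_K] assms(2) T(3) by (simp add: Int_absorb1)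
  then have "cell outer = T"
    using face_of_aff_dim_lt[of T "cell outer"] aff_dim_simplex T(2) outer_simplex
      convex_simplex by fastforce
  then show ?thesis using assms T(3) by blast
qed

lemma Int_outer:
  assumes "S \<in> K" "S \<noteq> cell outer"
  obtains \<tau> where "\<tau> \<subset> outer" "S \<inter> cell outer = cell \<tau>"
proof -
  have "(S \<inter> cell outer) face_of cell outer"
    using complex_Int[OF outer_in_K assms(1)] by (simp add: Int_commute)
  moreover have "S \<inter> cell outer \<noteq> cell outer"
    using outer_maximal assms by blast
  ultimately show ?thesis using proper_face_of_outer that by metis
qed

text \<open>By \<open>near\<close>, whatever \<open>S\<close> shares with a band cell lies in
  \<open>S \<inter> cell outer\<close>, a proper face of the old triangle. That face is a band face
  too, so the rest is an intersection within the realization. The same \<tau> serves every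
  \<sigma>.\<close>

lemma Int_cell:
  assumes "S \<in> K" "S \<noteq> cell outer"
  obtains \<tau> where "\<tau> \<subset> outer" "S \<inter> cell outer = cell \<tau>"
    "\<And>\<sigma>. \<sigma> \<in> band_faces \<Longrightarrow> S \<inter> cell \<sigma> = cell (\<tau> \<inter> \<sigma>)"
proof -
  obtain \<tau> where \<tau>: "\<tau> \<subset> outer" "S \<inter> cell outer = cell \<tau>"
    using Int_outer[OF assms] .
  have "S \<inter> cell \<sigma> = cell (\<tau> \<inter> \<sigma>)" if "\<sigma> \<in> band_faces" for \<sigma>
  proof -
    have "S \<inter> cell \<sigma> = cell \<tau> \<inter> cell \<sigma>"
      using near[OF assms that] \<tau>(2) by blast
    then show ?thesis using cell_Int subset_outer_face \<tau>(1) that by simp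
  qed
  then show ?thesis using that \<tau> by blast
qed

lemma cell_subset_K:
  assumes "cell \<sigma> \<subseteq> S" "S \<in> K" shows "\<sigma> \<subseteq> outer"
  using assms new_vertex vertex_in_cell by blast

lemma cell_psubset_outer:
  assumes "\<sigma> \<in> band_faces" "\<sigma> \<subseteq> outer" shows "\<sigma> \<subset> outer"
  using assms outer_not_band_face by auto

lemma patched_eq: "patched = (K - {cell outer}) \<union> new_cells"
proof -
  have "cell \<sigma> \<in> K - {cell outer}" if "\<sigma> \<in> band_faces" "\<sigma> \<subseteq> outer" for \<sigma>
    using that outer_face_in_K cell_psubset_outer by blast
  then show ?thesis unfolding patched_def new_cells_def by blast
qed

lemma new_cell_not_subset:
  assumes "N \<in> new_cells" "S \<in> K" shows "\<not> N \<subseteq> S"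
  using assms cell_subset_K unfolding new_cells_def by blast

lemma new_cells_disjoint: "K \<inter> new_cells = {}"
  using new_cell_not_subset by blast

lemma subset_cell_imp:
  assumes "S \<in> K" "S \<subseteq> cell \<sigma>" "\<sigma> \<in> band_faces"
  obtains \<tau> where "\<tau> \<subset> outer" "\<tau> \<subseteq> \<sigma>" "S = cell \<tau>"
proof -
  have "S \<noteq> cell outer" using assms outer_not_subset_cell by blast
  then obtain \<tau> where \<tau>: "\<tau> \<subset> outer" "S \<inter> cell \<sigma> = cell (\<tau> \<inter> \<sigma>)"
    using Int_cell[OF assms(1)] assms(3) by metis
  show ?thesis
  proof (rule that)
    show "\<tau> \<inter> \<sigma> \<subset> outer" "\<tau> \<inter> \<sigma> \<subseteq> \<sigma>" using \<tau>(1) by auto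
    show "S = cell (\<tau> \<inter> \<sigma>)" using \<tau>(2) assms(2) by (simp add: Int_absorb2)
  qed
qed

lemma complex_patched: "simplicial_complex patched"
  unfolding simplicial_complex_def
proof (intro conjI allI ballI impI)
  show "finite patched"
    using finite_complex by (simp add: patched_def)
  show "\<exists>n. n simplex S" if S: "S \<in> patched" for S
  proof (cases "S \<in> K")
    case False
    then obtain \<sigma> where "\<sigma> \<in> band_faces" "S = cell \<sigma>" using S by (auto simp: patched_def)
    then show ?thesis using simplex_cell_iff by (intro exI[of _ "int (card \<sigma>) - 1"]) simp
  qed (rule complex_simplex)
  show "F \<in> patched" if SF: "S \<in> patched \<and> F face_of S" for S F
  proof (cases "S \<in> K - {cell outer}")
    case True
    \<comment> \<open>The removed triangle is maximal, so it is not a face of any remaining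
      simplex.\<close>
    moreover have "F \<noteq> cell outer"
      using True SF outer_maximal face_of_imp_subset by blast
    ultimately show ?thesis
      using SF complex_face[of S F] by (simp add: patched_def)
  next
    case False
    then obtain \<sigma> where "\<sigma> \<in> band_faces" "S = cell \<sigma>" using SF by (auto simp: patched_def)
    then show ?thesis
      using SF face_of_cell_iff band_faces_subface by (auto simp: patched_def)
  qed
  \<comment> \<open>An old simplex and a new cell meet in a face of \<open>cell \<tau>\<close>, and
    \<open>cell \<tau>\<close> is itself a face of the old simplex, so transitivity applies.\<close>
  have mixed: "(S \<inter> cell \<sigma>) face_of S" "(S \<inter> cell \<sigma>) face_of cell \<sigma>"
    if S: "S \<in> K" "S \<noteq> cell outer" and \<sigma>: "\<sigma> \<in> band_faces" for S \<sigma>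
  proof -
    obtain \<tau> where \<tau>: "\<tau> \<subset> outer" "S \<inter> cell outer = cell \<tau>" "S \<inter> cell \<sigma> = cell (\<tau> \<inter> \<sigma>)"
      using Int_cell[OF S] \<sigma> by metis
    have "cell \<tau> face_of S" using complex_Int[OF S(1) outer_in_K] \<tau>(2) by simp
    moreover have "cell (\<tau> \<inter> \<sigma>) face_of cell \<tau>"
      using face_of_cell_iff[OF subset_outer_face[OF \<tau>(1)]] by blast
    ultimately show "(S \<inter> cell \<sigma>) face_of S" using \<tau>(3) face_of_trans by metis
    show "(S \<inter> cell \<sigma>) face_of cell \<sigma>" using \<tau>(3) face_of_cell_iff[OF \<sigma>] by auto
  qed
  have cells: "(cell \<sigma> \<inter> cell \<tau>) face_of cell \<sigma>" if "\<sigma> \<in> band_faces" "\<tau> \<in> band_faces" for \<sigma> \<tau>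
    using cell_Int[OF that] face_of_cell_iff[OF that(1)] by auto
  show "(S \<inter> S') face_of S" if "S \<in> patched \<and> S' \<in> patched" for S S'
  proof -
    consider "S \<in> K - {cell outer}" "S' \<in> K - {cell outer}"
      | \<sigma> where "S \<in> K - {cell outer}" "\<sigma> \<in> band_faces" "S' = cell \<sigma>"
      | \<sigma> where "S' \<in> K - {cell outer}" "\<sigma> \<in> band_faces" "S = cell \<sigma>"
      | \<sigma> \<tau> where "\<sigma> \<in> band_faces" "S = cell \<sigma>" "\<tau> \<in> band_faces" "S' = cell \<tau>"
      using \<open>S \<in> patched \<and> S' \<in> patched\<close> unfolding patched_def by blast
    then show ?thesis
    proof cases
      case 1 then show ?thesis using complex_Int by simp
    next
      case 2 then show ?thesis using mixed(1) by simp
    next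
      case 3 then show ?thesis using mixed(2) by (simp add: Int_commute)
    next
      case 4 then show ?thesis using cells by simp
    qed
  qed
qed

section \<open>Simplex counts, Euler characteristic and boundary\<close>

lemma simplices_patched:
  assumes "n = 0 \<or> n = 1"
  shows "{S \<in> patched. n simplex S} =
    {S \<in> K. n simplex S} \<union> cell ` {\<sigma> \<in> band_faces. \<not> \<sigma> \<subseteq> outer \<and> int (card \<sigma>) = n + 1}"
proof -
  have "\<not> n simplex cell outer" using assms simplex_dim_unique[OF outer_simplex, of n] by auto
  then show ?thesis unfolding patched_eq new_cells_def using simplex_cell_iff by auto
qed

lemma vertices_patched: "vertices patched = vertices K \<union> cell ` {{Vd}, {Ve}, {Vf}}"
proof -
  have "(int (card \<sigma>) = 0 + 1) = (card \<sigma> = 1)" for \<sigma> :: "vtx set" by linarith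
  then show ?thesis
    using simplices_patched[of 0] unfolding vertices_def inner_vertices[symmetric] by simp
qed

lemma edges_patched: "edges patched = edges K \<union> cell ` inner_edges"
proof -
  have "(int (card \<sigma>) = 1 + 1) = (card \<sigma> = 2)" for \<sigma> :: "vtx set" by linarith
  then show ?thesis
    using simplices_patched[of 1] unfolding edges_def inner_edges[symmetric] by simp
qed

lemma triangles_patched: "triangles patched = (triangles K - {cell outer}) \<union> cell ` band_triangles"
proof -
  have "(int (card \<sigma>) = 2 + 1) = (card \<sigma> = 3)" for \<sigma> :: "vtx set" by linarith
  then show ?thesis
    unfolding triangles_def patched_eq new_cells_def inner_triangles[symmetric]
    using simplex_cell_iff by auto
qed

lemma new_simplices:
  shows "cell ` {{Vd}, {Ve}, {Vf}} \<subseteq> new_cells" "cell ` inner_edges \<subseteq> new_cells"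
    "cell ` band_triangles \<subseteq> new_cells"
  unfolding inner_vertices[symmetric] inner_edges[symmetric] inner_triangles[symmetric] new_cells_def
  by blast+

text \<open>Three vertices, twelve edges and nine triangles are added and one triangle is lost: 3 -
  12 + 9 - 1 = -1.\<close>

lemma euler_char_patched: "euler_char patched = euler_char K - 1"
proof -
  have fin: "finite (vertices K)" "finite (edges K)" "finite (triangles K)"
    using finite_complex by (auto simp: vertices_def edges_def triangles_def)
  have sub: "vertices K \<subseteq> K" "edges K \<subseteq> K" "triangles K \<subseteq> K"
    by (auto simp: vertices_def edges_def triangles_def)
  have card: "card (cell ` X) = card X" if "X \<subseteq> band_faces" for X
    using that inj_on_cell by (simp add: card_image inj_on_subset)
  have X: "{{Vd}, {Ve}, {Vf}} \<subseteq> band_faces" "inner_edges \<subseteq> band_faces" "band_triangles \<subseteq> band_faces"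
    unfolding inner_vertices[symmetric] inner_edges[symmetric] inner_triangles[symmetric] by blast+
  have finX: "finite (cell ` X)" for X by simp
  have "card (vertices patched) = card (vertices K) + card (cell ` {{Vd}, {Ve}, {Vf}})"
    unfolding vertices_patched
    using sub(1) new_simplices(1) new_cells_disjoint by (intro card_Un_disjoint fin finX) blast
  moreover have "card (edges patched) = card (edges K) + card (cell ` inner_edges)"
    unfolding edges_patched
    using sub(2) new_simplices(2) new_cells_disjoint by (intro card_Un_disjoint fin finX) blast
  moreover have "card (triangles patched) = card (triangles K - {cell outer}) + card (cell ` band_triangles)"
    unfolding triangles_patched
    using sub(3) new_simplices(3) new_cells_disjoint
    by (intro card_Un_disjoint finX finite_Diff fin) blast
  moreover have "card (triangles K - {cell outer}) + 1 = card (triangles K)"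
    using outer_triangle fin(3) by (metis Suc_eq_plus1 card.remove)
  moreover have "card {{Vd}, {Ve}, {Vf}} = 3" by simp
  ultimately show ?thesis
    unfolding euler_char_def card[OF X(1)] card[OF X(2)] card[OF X(3)] card_inner_edges
      card_band_triangles by linarith
qed

text \<open>An edge of the removed triangle loses that triangle and gains exactly one band triangle.
  Any other old edge lies in no band triangle, because \<open>near\<close> would put it inside
  \<open>cell outer\<close>.\<close>

lemma card_triangles_at_old:
  assumes S: "S \<in> edges K" shows "card (triangles_at patched S) = card (triangles_at K S)"
proof (cases "S \<subseteq> cell outer")
  case True
  have "S face_of cell outer"
    using complex_Int[OF outer_in_K, of S] S True by (simp add: edges_def Int_absorb1)
  moreover have "S \<noteq> cell outer"
    using S simplex_dim_unique[OF outer_simplex, of 1] by (auto simp: edges_def)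
  ultimately obtain \<sigma> where \<sigma>: "\<sigma> \<subset> outer" "S = cell \<sigma>"
    using proper_face_of_outer by blast
  have "1 simplex cell \<sigma>" using S \<sigma> by (simp add: edges_def)
  then have "card \<sigma> = 2"
    unfolding simplex_cell_iff[OF subset_outer_face[OF \<sigma>(1)]] by simp
  have "triangles_at patched S = (triangles_at K S - {cell outer}) \<union> cell ` {\<tau> \<in> band_triangles. \<sigma> \<subseteq> \<tau>}"
    unfolding triangles_at_def triangles_patched \<sigma>(2)
    using cell_subset_iff[OF band_triangle_face] by blast
  also have "card \<dots> = card (triangles_at K S - {cell outer}) + card (cell ` {\<tau> \<in> band_triangles. \<sigma> \<subseteq> \<tau>})"
  proof (intro card_Un_disjoint)
    show "finite (triangles_at K S - {cell outer})"
      using finite_complex by (simp add: triangles_at_def triangles_def)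
    show "(triangles_at K S - {cell outer}) \<inter> cell ` {\<tau> \<in> band_triangles. \<sigma> \<subseteq> \<tau>} = {}"
      using new_simplices(3) new_cells_disjoint unfolding triangles_at_def triangles_def by blast
  qed simp
  also have "card (cell ` {\<tau> \<in> band_triangles. \<sigma> \<subseteq> \<tau>}) = card {\<tau> \<in> band_triangles. \<sigma> \<subseteq> \<tau>}"
    by (rule card_image, rule inj_on_subset[OF inj_on_cell]) (auto simp: band_triangle_face)
  also have "\<dots> = 1"
    using triangles_at_outer_edge \<sigma>(1) \<open>card \<sigma> = 2\<close> by blast
  also have "card (triangles_at K S - {cell outer}) + 1 = card (triangles_at K S)"
  proof -
    have "cell outer \<in> triangles_at K S" "finite (triangles_at K S)"
      using True outer_triangle finite_complex by (simp_all add: triangles_at_def triangles_def)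
    then show ?thesis by (metis Suc_eq_plus1 card.remove)
  qed
  finally show ?thesis .
next
  case False
  have SK: "S \<in> K" using S by (simp add: edges_def)
  have "\<not> S \<subseteq> cell \<tau>" if "\<tau> \<in> band_triangles" for \<tau>
    using near[OF SK _ band_triangle_face[OF that]] False by blast
  then have "triangles_at patched S = triangles_at K S"
    using False unfolding triangles_at_def triangles_patched by blast
  then show ?thesis by simp
qed

lemma card_triangles_at_new:
  assumes "\<sigma> \<in> inner_edges" shows "card (triangles_at patched (cell \<sigma>)) = 2"
proof -
  have "cell \<sigma> \<in> new_cells" using assms new_simplices by blast
  then have "\<not> cell \<sigma> \<subseteq> T" if "T \<in> triangles K" for T
    using new_cell_not_subset that by (simp add: triangles_def)
  then have "triangles_at patched (cell \<sigma>) = cell ` {\<tau> \<in> band_triangles. \<sigma> \<subseteq> \<tau>}"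
    unfolding triangles_at_def triangles_patched
    using cell_subset_iff[OF band_triangle_face] by blast
  moreover have "card (cell ` {\<tau> \<in> band_triangles. \<sigma> \<subseteq> \<tau>}) = card {\<tau> \<in> band_triangles. \<sigma> \<subseteq> \<tau>}"
    by (rule card_image, rule inj_on_subset[OF inj_on_cell]) (auto simp: band_triangle_face)
  ultimately show ?thesis using triangles_at_inner_edge[OF assms] by simp
qed

lemma surface_boundary_patched: "surface_boundary patched = surface_boundary K"
proof -
  have "{E \<in> edges patched. card (triangles_at patched E) = 1} = {E \<in> edges K. card (triangles_at K E) = 1}"
    unfolding edges_patched using card_triangles_at_old card_triangles_at_new by fastforce
  then show ?thesis unfolding surface_boundary_def by presburger
qed

text \<open>A face of the removed triangle may have lost the only triangle containing it, but it is
  a band face and so lies in a band triangle.\<close>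

lemma in_triangle_patched:
  assumes "S \<in> patched" shows "\<exists>T\<in>triangles patched. S \<subseteq> T"
proof -
  have cells: "\<exists>T\<in>triangles patched. cell \<sigma> \<subseteq> T" if "\<sigma> \<in> band_faces" for \<sigma>
    using band_face_subset[OF that] cell_mono unfolding triangles_patched by blast
  show ?thesis
  proof (cases "S \<in> K \<and> \<not> S \<subseteq> cell outer")
    case True
    then obtain T where "T \<in> triangles K" "S \<subseteq> T" using in_triangle by blast
    then show ?thesis using True unfolding triangles_patched by blast
  next
    case False
    then have "\<exists>\<sigma>\<in>band_faces. S = cell \<sigma>"
    proof (cases "S \<in> K - {cell outer}")
      case True
      then show ?thesis
        using False Int_outer[of S] subset_outer_face by (metis Diff_iff Int_absorb2 singletonI)
    qed (use assms in \<open>auto simp: patched_def\<close>)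
    then show ?thesis using cells by blast
  qed
qed

section \<open>Connectedness of the patched surface\<close>

lemma Union_patched: "\<Union>patched = \<Union>(K - {cell outer}) \<union> \<Union>(cell ` band_triangles)"
proof -
  have "cell \<sigma> \<subseteq> \<Union>(cell ` band_triangles)" if "\<sigma> \<in> band_faces" for \<sigma>
    using band_face_subset[OF that] cell_mono by blast
  then have "\<Union>(cell ` band_faces) = \<Union>(cell ` band_triangles)"
    using band_triangle_face by blast
  then show ?thesis unfolding patched_def by auto
qed

lemma closed_K: "S \<in> K \<Longrightarrow> closed S"
  using complex_simplex closed_simplex by blast

lemma closed_cell: "closed (cell \<sigma>)"
  by (simp add: cell_def compact_imp_closed finite_imp_compact_convex_hull)

lemma connected_cell: "connected (cell \<sigma>)"
  by (simp add: cell_def convex_connected)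

text \<open>Cells meet as soon as they share a vertex, so connectedness of a listed family becomes a
  check on vertex sets: each member needs a vertex in common with a later one.\<close>

lemma connected_cells_insert:
  assumes "connected (\<Union>(cell ` F))" "F = {} \<or> \<sigma> \<inter> \<Union>F \<noteq> {}"
  shows "connected (\<Union>(cell ` insert \<sigma> F))"
proof (cases "F = {}")
  case False
  then obtain i \<tau> where "i \<in> \<sigma>" "i \<in> \<tau>" "\<tau> \<in> F" using assms(2) by blast
  then have "cell \<sigma> \<inter> \<Union>(cell ` F) \<noteq> {}" using vertex_in_cell by blast
  then show ?thesis using connected_Un[OF connected_cell assms(1)] by simp
qed (simp add: connected_cell)

lemma connected_band: "connected (\<Union>(cell ` band_triangles))"
  unfolding band_triangles_def by (intro connected_cells_insert) simp_all

lemma connected_patched: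
  assumes "connected (\<Union>K)" shows "connected (\<Union>patched)"
  unfolding Union_patched
proof (rule connected_Un_exchange[where T = "cell outer"])
  show "connected (\<Union>(K - {cell outer}) \<union> cell outer)"
    using assms outer_in_K by (metis Union_insert insert_Diff sup_commute)
  show "closed (\<Union>(K - {cell outer}))"
    using finite_complex closed_K by (intro closed_Union) auto
  show "closed (\<Union>(cell ` band_triangles))"
    using closed_cell by (intro closed_Union) auto
  \<comment> \<open>The other simplices touch the removed triangle only in proper faces, and these
    belong to the band.\<close>
  show "\<Union>(K - {cell outer}) \<inter> cell outer \<subseteq> \<Union>(cell ` band_triangles)"
  proof (rule subsetI)
    fix x assume "x \<in> \<Union>(K - {cell outer}) \<inter> cell outer"
    then obtain S where x: "x \<in> cell outer" "x \<in> S" "S \<in> K" "S \<noteq> cell outer" by blast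
    then obtain \<tau> where \<tau>: "\<tau> \<subset> outer" "S \<inter> cell outer = cell \<tau>" using Int_outer by metis
    obtain \<sigma> where "\<sigma> \<in> band_triangles" "\<tau> \<subseteq> \<sigma>"
      using band_face_subset[OF subset_outer_face[OF \<tau>(1)]] by blast
    then have "\<exists>\<sigma>\<in>band_triangles. x \<in> cell \<sigma>"
      using x \<tau>(2) cell_mono by blast
    then show "x \<in> \<Union>(cell ` band_triangles)" by blast
  qed
  show "\<Union>(cell ` band_triangles) \<noteq> {}" by (simp add: band_triangles_def)
qed (simp_all add: closed_cell connected_band outer_def)

section \<open>Vertex links\<close>

definition link :: "vtx \<Rightarrow> vtx set set" where
  "link i = (\<Union>\<tau>\<in>band_triangles. if i \<in> \<tau> then {\<tau> - {i}} else {})"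

text \<open>The edges of each link are listed so that every one of them meets a later one.\<close>

lemma link_eq:
  "link Va = {{Vb, Vd}, {Vc, Vf}, {Vd, Ve}, {Ve, Vf}}"
  "link Vb = {{Va, Vd}, {Vc, Ve}, {Ve, Vf}, {Vf, Vd}}"
  "link Vc = {{Vb, Ve}, {Va, Vf}, {Vf, Vd}, {Vd, Ve}}"
  "link Vd = {{Va, Vb}, {Va, Ve}, {Vc, Ve}, {Vc, Vf}, {Vb, Vf}}"
  "link Ve = {{Vb, Vc}, {Vb, Vf}, {Va, Vf}, {Va, Vd}, {Vc, Vd}}"
  "link Vf = {{Vc, Va}, {Va, Ve}, {Vb, Ve}, {Vb, Vd}, {Vc, Vd}}"
  unfolding link_def band_triangles_def by (simp_all add: insert_Diff_if insert_commute)

lemma connected_link: "connected (\<Union>(cell ` link i))"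
  by (cases i; simp only: link_eq; intro connected_cells_insert; simp)

lemma closed_link: "closed (\<Union>(cell ` link i))"
  using closed_cell by (intro closed_Union) (auto simp: link_def)

lemma link_nonempty: "\<Union>(cell ` link i) \<noteq> {}"
  by (cases i) (simp_all add: link_eq)

lemma cell_subset_link:
  assumes "\<tau> \<in> band_faces" "insert i \<sigma> \<subseteq> \<tau>" "i \<notin> \<sigma>" shows "cell \<sigma> \<subseteq> \<Union>(cell ` link i)"
proof -
  obtain \<tau>' where "\<tau>' \<in> band_triangles" "insert i \<sigma> \<subseteq> \<tau>'"
    using band_face_subset assms by blast
  then have "\<tau>' - {i} \<in> link i" "\<sigma> \<subseteq> \<tau>' - {i}"
    using assms(3) by (auto simp: link_def)
  then show ?thesis using cell_mono by blast
qed

lemma patched_subset_cell: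
  assumes "S \<in> patched" "S \<subseteq> cell \<tau>" "\<tau> \<in> band_faces"
  obtains \<sigma> where "\<sigma> \<in> band_faces" "\<sigma> \<subseteq> \<tau>" "S = cell \<sigma>"
proof (cases "S \<in> K")
  case True
  then show ?thesis
    using subset_cell_imp[OF True assms(2,3)] subset_outer_face that by metis
next
  case False
  then obtain \<sigma> where "\<sigma> \<in> band_faces" "S = cell \<sigma>" using assms(1) unfolding patched_def by blast
  then show ?thesis using that assms cell_subset_iff by blast
qed

lemma link_subset_vertex_link: "\<Union>(cell ` link i) \<subseteq> vertex_link patched (p i)"
proof clarify
  fix x \<sigma> assume "\<sigma> \<in> link i" and x: "x \<in> cell \<sigma>"
  then obtain \<tau> where \<tau>: "\<tau> \<in> band_triangles" "i \<in> \<tau>" "\<sigma> = \<tau> - {i}"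
    by (auto simp: link_def split: if_splits)
  have \<sigma>: "\<sigma> \<in> band_faces" "i \<notin> \<sigma>"
    using \<tau> band_triangle_face band_faces_subface by blast+
  have "cell \<sigma> \<in> patched" "cell \<tau> \<in> patched"
    using \<sigma> band_triangle_face[OF \<tau>(1)] by (auto simp: patched_def)
  moreover have "p i \<notin> cell \<sigma>" "p i \<in> cell \<tau>" "cell \<sigma> \<subseteq> cell \<tau>"
    using \<sigma> vertex_in_cell_iff vertex_in_cell \<tau> cell_mono by auto
  ultimately show "x \<in> vertex_link patched (p i)"
    unfolding vertex_link_def using x by blast
qed

lemma in_link:
  assumes "S \<in> patched" "p i \<notin> S" "p i \<in> cell \<tau>" "S \<subseteq> cell \<tau>" "\<tau> \<in> band_faces"
  shows "S \<subseteq> \<Union>(cell ` link i)"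
proof -
  obtain \<sigma> where \<sigma>: "\<sigma> \<in> band_faces" "\<sigma> \<subseteq> \<tau>" "S = cell \<sigma>"
    using patched_subset_cell[OF assms(1,4,5)] .
  have "i \<notin> \<sigma>" using assms(2) \<sigma>(3) vertex_in_cell by blast
  moreover have "i \<in> \<tau>" using assms(3) vertex_in_cell_iff[OF assms(5)] by blast
  ultimately show ?thesis using cell_subset_link[OF assms(5)] \<sigma> by simp
qed

text \<open>No old simplex contains a new vertex, so its link is the pentagon it has in the
  band.\<close>

lemma connected_vertex_link_inner:
  assumes "i \<notin> outer" shows "connected (vertex_link patched (p i))"
proof -
  have "S \<subseteq> \<Union>(cell ` link i)"
    if S: "S \<in> patched" "p i \<notin> S" and T: "T \<in> patched" "p i \<in> T" "S \<subseteq> T" for S T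
  proof -
    have "T \<notin> K" using new_vertex[OF assms] T(2) by blast
    then obtain \<tau> where "\<tau> \<in> band_faces" "T = cell \<tau>" using T(1) unfolding patched_def by blast
    then show ?thesis using in_link S T by blast
  qed
  then have "vertex_link patched (p i) \<subseteq> \<Union>(cell ` link i)"
    unfolding vertex_link_def by blast
  then have "vertex_link patched (p i) = \<Union>(cell ` link i)"
    using link_subset_vertex_link by blast
  then show ?thesis using connected_link by simp
qed

text \<open>The edge of the removed triangle opposite to the vertex is exchanged for the path of
  four edges that is the vertex link in the band and has the same ends. The rest of the old link,
  \<open>far\<close>, is kept, so \<open>connected_Un_exchange\<close> applies.\<close>

lemma connected_vertex_link_outer:
  assumes i: "i \<in> outer" and conn: "connected (vertex_link K (p i))"
  shows "connected (vertex_link patched (p i))"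
proof -
  define far where "far = {S \<in> K. p i \<notin> S \<and> (\<exists>T\<in>K - {cell outer}. p i \<in> T \<and> S \<subseteq> T)}"
  have in_outer: "p i \<in> cell outer" using i vertex_in_cell by blast
  have opposite: "outer - {i} \<subset> outer" using i by blast
  have pi_opposite: "p i \<notin> cell (outer - {i})"
    using vertex_in_cell_iff subset_outer_face opposite by blast
  have "S \<subseteq> cell (outer - {i})" if S: "S \<in> K" "p i \<notin> S" "S \<subseteq> cell outer" for S
  proof -
    have "S \<noteq> cell outer" using S(2) in_outer by blast
    then obtain \<tau> where "\<tau> \<subset> outer" "S = cell \<tau>"
      using Int_outer[OF S(1)] S(3) by (metis Int_absorb2)
    then show ?thesis using S(2) vertex_in_cell cell_mono by (metis Diff_empty psubset_imp_subset subset_Diff_insert)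
  qed
  then have "vertex_link K (p i) \<subseteq> \<Union>far \<union> cell (outer - {i})"
    unfolding vertex_link_def far_def by blast
  moreover have "cell (outer - {i}) \<subseteq> vertex_link K (p i)"
    using outer_face_in_K[OF opposite] pi_opposite in_outer outer_in_K cell_mono[of "outer - {i}" outer]
    unfolding vertex_link_def by blast
  moreover have "\<Union>far \<subseteq> vertex_link K (p i)"
    unfolding vertex_link_def far_def by blast
  ultimately have old: "vertex_link K (p i) = \<Union>far \<union> cell (outer - {i})"
    by blast
  have "S \<in> far \<or> S \<subseteq> \<Union>(cell ` link i)"
    if S: "S \<in> patched" "p i \<notin> S" and T: "T \<in> patched" "p i \<in> T" "S \<subseteq> T" for S T
  proof (cases "T \<in> K - {cell outer}")
    case True
    then have "S \<in> K" using new_cell_not_subset S(1) T(3) unfolding patched_eq by blast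
    then show ?thesis using True S T by (auto simp: far_def)
  next
    case False
    then obtain \<tau> where "\<tau> \<in> band_faces" "T = cell \<tau>" using T(1) unfolding patched_def by blast
    then show ?thesis using in_link S T by blast
  qed
  then have "vertex_link patched (p i) \<subseteq> \<Union>far \<union> \<Union>(cell ` link i)"
    unfolding vertex_link_def by blast
  moreover have "S \<subseteq> vertex_link patched (p i)" if "S \<in> far" for S
  proof -
    have "S \<in> patched" using that in_outer unfolding far_def patched_def by blast
    then show ?thesis using that unfolding far_def vertex_link_def patched_def by blast
  qed
  ultimately have new: "vertex_link patched (p i) = \<Union>far \<union> \<Union>(cell ` link i)"
    using link_subset_vertex_link by blast
  show ?thesis
    unfolding new
  proof (rule connected_Un_exchange)
    show "connected (\<Union>far \<union> cell (outer - {i}))" using conn old by simp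
    show "closed (\<Union>far)"
      using finite_complex closed_K by (intro closed_Union) (auto simp: far_def)
    show "cell (outer - {i}) \<noteq> {}" by (cases i) (simp_all add: outer_def)
    \<comment> \<open>If \<open>S\<close> in \<open>far\<close> lies in \<open>T\<close>, the traces
      \<sigma> of \<open>S\<close> and \<tau> of \<open>T\<close> on the old triangle satisfy
      \<sigma> \<subseteq> \<tau> with \<open>i\<close> in \<tau> but not in \<sigma>. As \<tau> is
      a band face, \<open>cell \<sigma>\<close> lies on the new path.\<close>
    show "\<Union>far \<inter> cell (outer - {i}) \<subseteq> \<Union>(cell ` link i)"
    proof clarify
      fix x S assume x: "x \<in> cell (outer - {i})" "x \<in> S" and S: "S \<in> far"
      then obtain T where T: "T \<in> K" "T \<noteq> cell outer" "p i \<in> T" "S \<subseteq> T"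
        and S': "S \<in> K" "p i \<notin> S" unfolding far_def by blast
      have "S \<noteq> cell outer" using S'(2) in_outer by blast
      then obtain \<sigma> where \<sigma>: "\<sigma> \<subset> outer" "S \<inter> cell outer = cell \<sigma>" using Int_outer S'(1) by metis
      obtain \<tau> where \<tau>: "\<tau> \<subset> outer" "T \<inter> cell outer = cell \<tau>" using Int_outer T(1,2) by metis
      have "cell \<sigma> \<subseteq> cell \<tau>" using \<sigma> \<tau> T(4) by blast
      then have "\<sigma> \<subseteq> \<tau>" using cell_subset_iff subset_outer_face \<tau>(1) by blast
      moreover have "i \<in> \<tau>"
        using vertex_in_cell_iff[OF subset_outer_face[OF \<tau>(1)]] \<tau>(2) T(3) in_outer by blast
      moreover have "i \<notin> \<sigma>" using vertex_in_cell[of i \<sigma>] \<sigma>(2) S'(2) by blast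
      ultimately have "cell \<sigma> \<subseteq> \<Union>(cell ` link i)"
        using cell_subset_link[OF subset_outer_face[OF \<tau>(1)]] by simp
      moreover have "x \<in> cell \<sigma>"
        using x \<sigma>(2) cell_mono[of "outer - {i}" outer] by blast
      ultimately show "x \<in> \<Union>(cell ` link i)" by blast
    qed
  qed (use closed_cell closed_link connected_link link_nonempty in blast)+
qed

text \<open>A vertex of \<open>K\<close> in the removed triangle is one of its corners, so this one
  lies off the triangle and, by \<open>near\<close>, off the band; no simplex around it
  changes.\<close>

lemma vertex_link_other:
  assumes v: "{v} \<in> patched" "v \<notin> range p"
  shows "{v} \<in> K" "vertex_link patched v = vertex_link K v"
proof -
  have not_cell: "cell \<sigma> \<noteq> {v}" for \<sigma>
  proof
    assume *: "cell \<sigma> = {v}"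
    then obtain j where "j \<in> \<sigma>" by (metis cell_empty ex_in_conv insert_not_empty)
    then show False using vertex_in_cell[of j \<sigma>] * v(2) by auto
  qed
  then show vK: "{v} \<in> K" using v(1) unfolding patched_def by auto
  have "v \<notin> cell outer"
  proof
    assume "v \<in> cell outer"
    then have "{v} face_of cell outer"
      using complex_Int[OF outer_in_K vK] by (simp add: Int_absorb1)
    then show False using face_of_outer_iff not_cell by metis
  qed
  moreover from this have "v \<notin> cell \<sigma>" if "\<sigma> \<in> band_faces" for \<sigma>
    using near[OF vK _ that] not_cell by (metis IntI insertI1 subsetD)
  ultimately have T: "T \<in> patched \<and> v \<in> T \<longleftrightarrow> T \<in> K \<and> v \<in> T" for T
    unfolding patched_def by blast
  have "S \<in> patched \<longleftrightarrow> S \<in> K" if "T \<in> K" "v \<in> T" "S \<subseteq> T" for S T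
  proof -
    have "S \<noteq> cell outer" using that outer_maximal \<open>v \<notin> cell outer\<close> by blast
    then show ?thesis using new_cell_not_subset that unfolding patched_eq by blast
  qed
  then show "vertex_link patched v = vertex_link K v"
    unfolding vertex_link_def using T by blast
qed

lemma triangulated_surface_patched: "triangulated_surface patched"
  unfolding triangulated_surface_def
proof (intro conjI ballI allI impI)
  show "card (triangles_at patched E) \<in> {1, 2}" if "E \<in> edges patched" for E
  proof (cases "E \<in> edges K")
    case True
    then show ?thesis using card_triangles_at_old surface by (simp add: triangulated_surface_def)
  next
    case False
    then show ?thesis using that card_triangles_at_new unfolding edges_patched by blast
  qed
  show "connected (vertex_link patched v)" if v: "{v} \<in> patched" for v
  proof -
    have K: "connected (vertex_link K w)" if "{w} \<in> K" for w
      using surface that by (simp add: triangulated_surface_def)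
    consider i where "v = p i" "i \<in> outer" | i where "v = p i" "i \<notin> outer" | "v \<notin> range p" by blast
    then show ?thesis
    proof cases
      case 1
      have "{i} \<subset> outer" using \<open>i \<in> outer\<close> by (auto simp: outer_def)
      then have "{p i} \<in> K" using outer_face_in_K[of "{i}"] by simp
      then show ?thesis using 1 connected_vertex_link_outer K by blast
    next
      case 2
      then show ?thesis using connected_vertex_link_inner by blast
    next
      case 3
      then show ?thesis using vertex_link_other v K by metis
    qed
  qed
qed (use complex_patched in_triangle_patched in auto)

section \<open>Non-orientability\<close>

lemma triangle_orientations_cell:
  assumes "{i, j, k} \<in> band_triangles" "R \<in> triangle_orientations (cell {i, j, k})"
  shows "R = {(p i, p j), (p j, p k), (p k, p i)} \<or> R = {(p j, p i), (p i, p k), (p k, p j)}"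
proof -
  obtain a b c where abc: "card {a, b, c} = 3" "cell {i, j, k} = convex hull {a, b, c}"
    and R: "R = {(a, b), (b, c), (c, a)}"
    using assms(2) unfolding triangle_orientations_def by blast
  have "card {i, j, k} = 3" using assms(1) inner_triangles by blast
  then have "card (p ` {i, j, k}) = card {a, b, c}" using card_vertices abc(1) by metis
  moreover have "p ` {i, j, k} \<subseteq> {a, b, c}"
  proof
    fix x assume "x \<in> p ` {i, j, k}"
    \<comment> \<open>The corners of a triangle are its extreme points, so any three points spanning
      it are the images of \<open>i\<close>, \<open>j\<close>, \<open>k\<close> in some
      order.\<close>
    then have "x extreme_point_of cell {i, j, k}"
      using extreme_point_of_convex_hull_affine_independent
        affine_independent_vertices[OF band_triangle_face[OF assms(1)]]
      unfolding cell_def by blast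
    then show "x \<in> {a, b, c}" unfolding abc(2) by (rule extreme_point_of_convex_hull)
  qed
  ultimately have eq: "{p i, p j, p k} = {a, b, c}"
    using card_subset_eq[of "{a, b, c}" "p ` {i, j, k}"] by simp
  have "p i \<in> {a, b, c}" "p j \<in> {a, b, c}" "p k \<in> {a, b, c}"
    using eq by blast+
  moreover have "p i \<noteq> p j" "p j \<noteq> p k" "p i \<noteq> p k"
    using abc(1) unfolding eq[symmetric] by (auto simp: card_insert_if split: if_splits)
  ultimately have "p i = a \<and> p j = b \<and> p k = c \<or> p i = b \<and> p j = c \<and> p k = a \<or> p i = c \<and> p j = a \<and> p k = b \<or>
    p i = a \<and> p j = c \<and> p k = b \<or> p i = b \<and> p j = a \<and> p k = c \<or> p i = c \<and> p j = b \<and> p k = a"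
    by - (elim insertE emptyE; simp)
  then show ?thesis unfolding R by auto
qed

text \<open>The six band triangles with an edge of \<open>def\<close> form a closed strip:
  \<open>aef\<close>, \<open>bef\<close>, \<open>bfd\<close>, \<open>cfd\<close>,
  \<open>cde\<close>, \<open>ade\<close>, and again \<open>aef\<close>. Transporting an orientation
  once around it reverses the direction of \<open>ef\<close>.\<close>

lemma not_orientable_patched: "\<not> orientable patched"
proof
  assume "orientable patched"
  then obtain orient where *: "(\<forall>T\<in>triangles patched. orient T \<in> triangle_orientations T) \<and>
      (\<forall>T\<in>triangles patched. \<forall>T'\<in>triangles patched. T \<noteq> T' \<longrightarrow> orient T \<inter> orient T' = {})"
    unfolding orientable_def by (rule exE)
  have orient: "orient T \<in> triangle_orientations T" if "T \<in> triangles patched" for T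
    using * that by simp
  have coherent: "orient T \<inter> orient T' = {}"
    if "T \<in> triangles patched" "T' \<in> triangles patched" "T \<noteq> T'" for T T'
    using * that by simp
  define dir where "dir i j \<tau> \<longleftrightarrow> (p i, p j) \<in> orient (cell \<tau>)" for i j \<tau>
  have in_patched: "cell \<tau> \<in> triangles patched" if "\<tau> \<in> band_triangles" for \<tau>
    using that unfolding triangles_patched by blast
  have orientation: "orient (cell {i, j, k}) = {(p i, p j), (p j, p k), (p k, p i)} \<or>
      orient (cell {i, j, k}) = {(p j, p i), (p i, p k), (p k, p j)}"
    if "{i, j, k} \<in> band_triangles" for i j k
    using triangle_orientations_cell[OF that orient[OF in_patched[OF that]]] .
  have distinct: "i \<noteq> j" "j \<noteq> k" "i \<noteq> k" if "{i, j, k} \<in> band_triangles" for i j k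
  proof -
    have "card {i, j, k} = 3" using that inner_triangles by blast
    then show "i \<noteq> j" "j \<noteq> k" "i \<noteq> k" by (auto simp: card_insert_if split: if_splits)
  qed
  have either: "dir i j {i, j, k} \<or> dir j i {i, j, k}" if "{i, j, k} \<in> band_triangles" for i j k
    using orientation[OF that] unfolding dir_def by blast
  have positive: "orient (cell {i, j, k}) = {(p i, p j), (p j, p k), (p k, p i)}"
    if "{i, j, k} \<in> band_triangles" "dir i j {i, j, k}" for i j k
    using orientation[OF that(1)]
  proof
    assume "orient (cell {i, j, k}) = {(p j, p i), (p i, p k), (p k, p j)}"
    then show ?thesis
      using that(2) distinct[OF that(1)] by (simp add: dir_def inj_eq[OF inj_p])
  qed
  have turn: "dir j k {i, j, k} \<and> dir k i {i, j, k}"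
    if "{i, j, k} \<in> band_triangles" "dir i j {i, j, k}" for i j k
    using positive[OF that] by (simp add: dir_def)
  have disjoint: "\<not> dir i j \<tau>'" if "dir i j \<tau>" "\<tau> \<in> band_triangles" "\<tau>' \<in> band_triangles" "\<tau> \<noteq> \<tau>'" for i j \<tau> \<tau>'
  proof -
    have "cell \<tau> \<noteq> cell \<tau>'"
      using that inj_on_cell band_triangle_face by (meson inj_onD)
    then show ?thesis using coherent[OF in_patched in_patched] that unfolding dir_def by blast
  qed
  \<comment> \<open>One move along the strip: the next triangle traverses the shared edge backwards,
    from \<open>j\<close> to \<open>i\<close>, and therefore continues from \<open>i\<close> to
    \<open>l\<close> and from \<open>l\<close> to \<open>j\<close>.\<close>
  have strip: "dir i l \<tau>' \<and> dir l j \<tau>'"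
    if \<tau>: "\<tau> \<in> band_triangles" "\<tau> = {i, j, k}" and \<tau>': "\<tau>' \<in> band_triangles" "\<tau>' = {i, j, l}"
      and "k \<noteq> l" "dir i j \<tau>" for \<tau> \<tau>' i j k l
  proof -
    have jil: "{j, i, l} \<in> band_triangles" "\<tau>' = {j, i, l}" using \<tau>' by (simp_all add: insert_commute)
    have "\<tau> \<noteq> \<tau>'"
      using \<open>k \<noteq> l\<close> distinct[of i j k] \<tau> \<tau>' by auto
    then have "\<not> dir i j \<tau>'" using disjoint \<tau>(1) \<tau>'(1) that(6) by blast
    then have "dir j i {j, i, l}" using either[OF jil(1)] jil(2) by blast
    then show ?thesis using turn[OF jil(1)] jil(2) by blast
  qed
  have antisym: "\<not> dir j i {i, j, k}" if "{i, j, k} \<in> band_triangles" "dir i j {i, j, k}" for i j k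
    using positive[OF that] distinct[OF that(1)] by (simp add: dir_def inj_eq[OF inj_p])
  \<comment> \<open>The second case is the first with all directions reversed.\<close>
  consider "dir Ve Vf {Va, Ve, Vf}" | "dir Vf Ve {Va, Ve, Vf}"
    using either[of Ve Vf Va] by (auto simp: band_triangles_def insert_commute)
  then show False
  proof cases
    case 1
    have *: "dir Vb Vf {Vb, Ve, Vf}"
      by (rule strip[of "{Va, Ve, Vf}" Ve Vf Va "{Vb, Ve, Vf}" Vb, THEN conjunct2])
        (use 1 in \<open>simp_all add: band_triangles_def insert_commute\<close>)
    have *: "dir Vd Vf {Vb, Vf, Vd}"
      by (rule strip[of "{Vb, Ve, Vf}" Vb Vf Ve "{Vb, Vf, Vd}" Vd, THEN conjunct2])
        (use * in \<open>simp_all add: band_triangles_def insert_commute\<close>)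
    have *: "dir Vd Vc {Vc, Vf, Vd}"
      by (rule strip[of "{Vb, Vf, Vd}" Vd Vf Vb "{Vc, Vf, Vd}" Vc, THEN conjunct1])
        (use * in \<open>simp_all add: band_triangles_def insert_commute\<close>)
    have *: "dir Vd Ve {Vc, Vd, Ve}"
      by (rule strip[of "{Vc, Vf, Vd}" Vd Vc Vf "{Vc, Vd, Ve}" Ve, THEN conjunct1])
        (use * in \<open>simp_all add: band_triangles_def insert_commute\<close>)
    have *: "dir Va Ve {Va, Vd, Ve}"
      by (rule strip[of "{Vc, Vd, Ve}" Vd Ve Vc "{Va, Vd, Ve}" Va, THEN conjunct2])
        (use * in \<open>simp_all add: band_triangles_def insert_commute\<close>)
    have "dir Vf Ve {Va, Ve, Vf}"
      by (rule strip[of "{Va, Vd, Ve}" Va Ve Vd "{Va, Ve, Vf}" Vf, THEN conjunct2])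
        (use * in \<open>simp_all add: band_triangles_def insert_commute\<close>)
    then show False
      using antisym[of Ve Vf Va] 1 by (simp add: band_triangles_def insert_commute)
  next
    case 2
    have *: "dir Vf Vb {Vb, Ve, Vf}"
      by (rule strip[of "{Va, Ve, Vf}" Vf Ve Va "{Vb, Ve, Vf}" Vb, THEN conjunct1])
        (use 2 in \<open>simp_all add: band_triangles_def insert_commute\<close>)
    have *: "dir Vf Vd {Vb, Vf, Vd}"
      by (rule strip[of "{Vb, Ve, Vf}" Vf Vb Ve "{Vb, Vf, Vd}" Vd, THEN conjunct1])
        (use * in \<open>simp_all add: band_triangles_def insert_commute\<close>)
    have *: "dir Vc Vd {Vc, Vf, Vd}"
      by (rule strip[of "{Vb, Vf, Vd}" Vf Vd Vb "{Vc, Vf, Vd}" Vc, THEN conjunct2])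
        (use * in \<open>simp_all add: band_triangles_def insert_commute\<close>)
    have *: "dir Ve Vd {Vc, Vd, Ve}"
      by (rule strip[of "{Vc, Vf, Vd}" Vc Vd Vf "{Vc, Vd, Ve}" Ve, THEN conjunct2])
        (use * in \<open>simp_all add: band_triangles_def insert_commute\<close>)
    have *: "dir Ve Va {Va, Vd, Ve}"
      by (rule strip[of "{Vc, Vd, Ve}" Ve Vd Vc "{Va, Vd, Ve}" Va, THEN conjunct1])
        (use * in \<open>simp_all add: band_triangles_def insert_commute\<close>)
    have "dir Ve Vf {Va, Ve, Vf}"
      by (rule strip[of "{Va, Vd, Ve}" Ve Va Vd "{Va, Ve, Vf}" Vf, THEN conjunct1])
        (use * in \<open>simp_all add: band_triangles_def insert_commute\<close>)
    then show False
      using antisym[of Ve Vf Va] 2 by (simp add: band_triangles_def insert_commute)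
  qed
qed

end

section \<open>Placing the band near a boundary edge\<close>

text \<open>The hyperplane comes from separating the closed cone spanned by the differences \<open>s - t\<close>
  from the compact set of the \<open>q - s\<close>.\<close>

lemma separating_hyperplane_polytopes:
  fixes S T :: "'a::euclidean_space set"
  assumes "polytope S" "polytope T" "S \<noteq> {}" "q \<in> T" "(S \<inter> T) face_of T" "q \<notin> S"
  obtains n \<beta> where "\<And>x. x \<in> S \<Longrightarrow> n \<bullet> x \<le> \<beta>" "\<And>x. x \<in> T \<Longrightarrow> \<beta> \<le> n \<bullet> x" "\<beta> < n \<bullet> q"
proof -
  define D where "D = (\<lambda>(s, t). s - t) ` (S \<times> T)"
  have lin: "linear (\<lambda>(s :: 'a, t). s - t)"
    by (rule linearI) (auto simp: algebra_simps)
  have "polytope D"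
    unfolding D_def using assms(1,2) lin by (intro polytope_linear_image polytope_Times)
  have convex: "convex S" "convex T" and "compact S"
    using assms(1,2) polytope_imp_convex polytope_imp_compact by auto
  \<comment> \<open>The conic hull of a polytope is closed even if the polytope contains 0, as
    \<open>D\<close> does when \<open>S\<close> and \<open>T\<close> meet.\<close>
  have cone: "closed (conic hull D)" "convex (conic hull D)"
    using \<open>polytope D\<close> by (auto intro: closed_conic_hull_strong convex_conic_hull polytope_imp_convex)
  have "(\<lambda>s. q - s) ` S = (+) q ` uminus ` S" by (auto simp: image_image)
  then have "convex ((\<lambda>s. q - s) ` S)" using convex by (simp add: convex_negations convex_translation)
  moreover have "compact ((\<lambda>s. q - s) ` S)"
    using \<open>compact S\<close> by (intro compact_continuous_image continuous_intros)
  moreover have "conic hull D \<inter> (\<lambda>s. q - s) ` S = {}"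
  proof (rule ccontr)
    assume "conic hull D \<inter> (\<lambda>s. q - s) ` S \<noteq> {}"
    then obtain s where s: "s \<in> S" "q - s \<in> conic hull D" by auto
    then obtain c d where c: "0 \<le> c" "q - s = c *\<^sub>R d" "d \<in> D"
      unfolding conic_hull_explicit by blast
    then obtain s' t where st: "s' \<in> S" "t \<in> T" and eq: "q - s = c *\<^sub>R (s' - t)"
      unfolding D_def by auto
    \<comment> \<open>The relation rearranges to \<open>q + c t = s + c s'\<close>. Divided by
      \<open>1 + c\<close>, the left side is a point of \<open>T\<close> on the open segment from
      \<open>q\<close> to \<open>t\<close> and the right side a point of \<open>S\<close>; the face
      property then puts \<open>q\<close> into \<open>S\<close>.\<close>
    define z where "z = (1 / (1 + c)) *\<^sub>R q + (c / (1 + c)) *\<^sub>R t"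
    have sum1: "1 / (1 + c) + c / (1 + c) = 1" using c(1) by (simp add: field_simps)
    have zq: "(1 + c) *\<^sub>R z = q + c *\<^sub>R t" using c(1) by (simp add: z_def scaleR_add_right)
    also have "\<dots> = s + c *\<^sub>R s'" using eq by (simp add: algebra_simps)
    finally have "(1 / (1 + c)) *\<^sub>R ((1 + c) *\<^sub>R z) = (1 / (1 + c)) *\<^sub>R (s + c *\<^sub>R s')" by simp
    then have "z = (1 / (1 + c)) *\<^sub>R s + (c / (1 + c)) *\<^sub>R s'"
      using c(1) by (simp add: scaleR_add_right)
    then have "z \<in> S" using convex(1) s(1) st(1) sum1 c(1) by (simp add: convexD)
    moreover have "z \<in> T" unfolding z_def using convex(2) assms(4) st(2) sum1 c(1) by (simp add: convexD)
    ultimately have z: "z \<in> S \<inter> T" by blast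
    have "c \<noteq> 0" using eq s(1) assms(6) by auto
    moreover have "q \<noteq> t"
    proof
      assume "q = t"
      then have "z = q" using sum1 unfolding z_def by (metis scaleR_add_left scaleR_one)
      then show False using z assms(6) by blast
    qed
    ultimately have "z \<in> open_segment q t"
      unfolding in_segment z_def using c(1) sum1
      by (intro conjI exI[of _ "c / (1 + c)"]) (auto simp: field_simps)
    then show False using assms(4,5,6) st(2) z unfolding face_of_def by blast
  qed
  moreover have "(\<lambda>s. q - s) ` S \<noteq> {}" using assms(3) by blast
  ultimately obtain n b where "\<forall>x\<in>conic hull D. n \<bullet> x < b" "\<forall>y\<in>(\<lambda>s. q - s) ` S. n \<bullet> y > b"
    using separating_hyperplane_closed_compact[OF cone(2,1)] by metis
  then have n: "\<And>x. x \<in> conic hull D \<Longrightarrow> n \<bullet> x < b" "\<And>s. s \<in> S \<Longrightarrow> n \<bullet> (q - s) > b"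
    by blast+
  have scaled: "c * (n \<bullet> (s - t)) < b" if "s \<in> S" "t \<in> T" "0 \<le> c" for s t c
  proof -
    have "c *\<^sub>R (s - t) \<in> conic hull D"
      unfolding conic_hull_explicit D_def using that by force
    then show ?thesis using n(1) by fastforce
  qed
  \<comment> \<open>The cone contains 0. A functional bounded above on a cone is nonpositive there,
    which gives the weak inequality between \<open>S\<close> and \<open>T\<close> below.\<close>
  have "b > 0" using scaled[of _ q 0] assms(3,4) by auto
  have le: "n \<bullet> s \<le> n \<bullet> t" if "s \<in> S" "t \<in> T" for s t
  proof (rule ccontr)
    assume "\<not> n \<bullet> s \<le> n \<bullet> t"
    then have "n \<bullet> (s - t) > 0" by (simp add: inner_diff_right)
    then show False using scaled[OF that, of "b / (n \<bullet> (s - t))"] \<open>b > 0\<close> by simp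
  qed
  have "continuous_on S (\<lambda>s. n \<bullet> s)" by (intro continuous_intros)
  \<comment> \<open>The level \<beta> is the maximum of the functional on \<open>S\<close>; at
    \<open>q\<close> it is exceeded by more than \<open>b\<close>.\<close>
  then obtain s0 where s0: "s0 \<in> S" "\<forall>s\<in>S. n \<bullet> s \<le> n \<bullet> s0"
    using continuous_attains_sup[OF \<open>compact S\<close> assms(3)] by blast
  show ?thesis
    using that[of n "n \<bullet> s0"] s0 le n(2)[OF s0(1)] \<open>b > 0\<close> by (simp add: inner_diff_right)
qed

text \<open>The disjuncts are the complements of the nine band triangles in their listed order; this
  form of being carried by a face is open to linear arithmetic.\<close>

lemma outside_band_triangle:
  fixes f :: "vtx \<Rightarrow> real"
  assumes "\<sigma> \<in> band_faces" "{i. 0 < f i} \<subseteq> \<sigma>"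
  shows "f Vc \<le> 0 \<and> f Ve \<le> 0 \<and> f Vf \<le> 0 \<or>
    f Va \<le> 0 \<and> f Vd \<le> 0 \<and> f Vf \<le> 0 \<or>
    f Vb \<le> 0 \<and> f Vd \<le> 0 \<and> f Ve \<le> 0 \<or>
    f Vb \<le> 0 \<and> f Vc \<le> 0 \<and> f Vf \<le> 0 \<or>
    f Va \<le> 0 \<and> f Vc \<le> 0 \<and> f Vd \<le> 0 \<or>
    f Va \<le> 0 \<and> f Vb \<le> 0 \<and> f Ve \<le> 0 \<or>
    f Vb \<le> 0 \<and> f Vc \<le> 0 \<and> f Vd \<le> 0 \<or>
    f Va \<le> 0 \<and> f Vc \<le> 0 \<and> f Ve \<le> 0 \<or>
    f Va \<le> 0 \<and> f Vb \<le> 0 \<and> f Vf \<le> 0"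
proof -
  obtain \<tau> where \<tau>: "\<tau> \<in> band_triangles" "{i. 0 < f i} \<subseteq> \<tau>"
    using band_face_subset[OF assms(1)] assms(2) by blast
  have "f i \<le> 0" if "i \<notin> \<tau>" for i
    using \<tau>(2) that by force
  then show ?thesis
    using \<tau>(1) unfolding band_triangles_def by (elim insertE emptyE; simp)
qed

text \<open>The dependencies of the points \<open>- u\<close>, \<open>u\<close>, \<open>v\<close>, \<open>\<epsilon> (- u + v + m)\<close>, \<open>- \<epsilon> m\<close>, \<open>\<epsilon> (u - v + 2 m)\<close>
  are given by the equations below, with \<open>u\<close>, \<open>v\<close>, \<open>m\<close> linearly independent.\<close>

lemma band_dependency_signs:
  fixes w :: "vtx \<Rightarrow> real"
  assumes eqs: "w Vd - w Ve + 2 * w Vf = 0" "w Vb - w Va + w Vc = 0"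
      "w Va + w Vb + w Vc + w Vd + w Ve + w Vf = 0"
    and c: "w Vc = \<epsilon> * (w Vf - w Vd)" "0 < \<epsilon>" "\<epsilon> \<le> 1 / 10"
    and faces: "{i. 0 < w i} \<in> band_faces" "{i. w i < 0} \<in> band_faces"
  shows "w i = 0"
proof -
  \<comment> \<open>The only nonlinear equation is replaced by linear consequences: the sign of
    \<open>w Vc\<close> and a bound on its size. The constant 1/10 keeps \<open>w Vc\<close> small:
    if \<open>w Ve < 0 < w Vf\<close>, for instance, \<open>w Vb\<close> stays positive, so the
    positive set is not the face \<open>{Vc, Va, Vf}\<close>.\<close>
  have c_cases: "w Vd < w Vf \<and> 0 < w Vc \<and> 10 * w Vc \<le> w Vf - w Vd \<or>
      w Vf < w Vd \<and> w Vc < 0 \<and> w Vf - w Vd \<le> 10 * w Vc \<or> w Vd = w Vf \<and> w Vc = 0"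
  proof (cases "w Vd" "w Vf" rule: linorder_cases)
    case less
    then have "w Vc \<le> 1 / 10 * (w Vf - w Vd)" unfolding c(1) using c by (intro mult_right_mono) auto
    moreover have "0 < w Vc" unfolding c(1) using less c(2) by simp
    ultimately show ?thesis using less by simp
  next
    case greater
    have eq: "- w Vc = \<epsilon> * (w Vd - w Vf)" using c(1) by (simp add: algebra_simps)
    have "- w Vc \<le> 1 / 10 * (w Vd - w Vf)" unfolding eq using greater c by (intro mult_right_mono) auto
    moreover have "0 < - w Vc" unfolding eq using greater c(2) by simp
    ultimately show ?thesis using greater by simp
  qed (use c in simp)
  have coords: "w Ve = w Vd + 2 * w Vf" "2 * w Va = - 2 * w Vd - 3 * w Vf"
      "2 * w Vb = - 2 * w Vd - 3 * w Vf - 2 * w Vc"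
    using eqs by linarith+
  note nonpos = outside_band_triangle[OF faces(1), of w, OF order_refl]
  note nonneg = outside_band_triangle[OF faces(2), of "\<lambda>i. - w i", simplified]
  have "w Vd = 0 \<and> w Vf = 0"
    using c_cases
  proof (elim disjE conjE)
    assume "w Vd < w Vf" "0 < w Vc" "10 * w Vc \<le> w Vf - w Vd"
    then have False
      using nonpos nonneg coords by (elim disjE conjE) linarith+
    then show ?thesis ..
  next
    assume "w Vf < w Vd" "w Vc < 0" "w Vf - w Vd \<le> 10 * w Vc"
    then have False
      using nonpos nonneg coords by (elim disjE conjE) linarith+
    then show ?thesis ..
  next
    assume "w Vd = w Vf" "w Vc = 0"
    \<comment> \<open>Here \<open>w Ve = 3 * w Vd\<close>, so a nonzero value would give
      \<open>Vd\<close>, \<open>Ve\<close>, \<open>Vf\<close> the same sign, and these three span no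
      face.\<close>
    moreover from this have "w Vd = 0"
      using nonpos nonneg coords by (elim disjE conjE) linarith+
    ultimately show ?thesis by simp
  qed
  then show ?thesis using eqs c by (cases i) auto
qed

section \<open>Coordinates of the band vertices\<close>

lemma affine_independent_3:
  fixes a b c :: "'a::euclidean_space"
  assumes "\<not> affine_dependent {a, b, c}" "a \<noteq> b" "b \<noteq> c" "a \<noteq> c"
    and "x + y + z = 0" "x *\<^sub>R a + y *\<^sub>R b + z *\<^sub>R c = 0"
  shows "x = 0 \<and> y = 0 \<and> z = 0"
proof (rule ccontr)
  assume nz: "\<not> ?thesis"
  define U where "U t = (if t = a then x else if t = b then y else z)" for t
  have "sum U {a, b, c} = 0" "\<exists>t\<in>{a, b, c}. U t \<noteq> 0" "(\<Sum>t\<in>{a, b, c}. U t *\<^sub>R t) = 0"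
    using assms nz by (auto simp: U_def add.assoc)
  then show False
    using assms(1) affine_dependent_explicit_finite[of "{a, b, c}"] by auto
qed

lemma sum_vtx: "(\<Sum>i\<in>UNIV. f i) = f Va + f Vb + f Vc + f Vd + f Ve + f Vf"
  for f :: "vtx \<Rightarrow> 'b::comm_monoid_add"
  by (simp add: UNIV_vtx add.assoc)

text \<open>In use, \<open>q\<close> is the midpoint of \<open>ab\<close>, \<open>u\<close> half of
  \<open>b - a\<close>, \<open>v = c - q\<close>, and \<open>m\<close> is normal to the plane of
  \<open>abc\<close>. The coefficients are chosen so that \<open>d + 3 e + f = 5 q\<close>: the
  midpoint is interior to the triangle \<open>def\<close>, whose plane is transversal to
  \<open>u\<close>, so \<open>def\<close> encircles \<open>ab\<close>. The heights 1, -1, 2 along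
  \<open>m\<close> keep the new vertices off the plane of \<open>abc\<close>.\<close>

definition band_position :: "'a \<Rightarrow> 'a \<Rightarrow> 'a \<Rightarrow> 'a \<Rightarrow> real \<Rightarrow> vtx \<Rightarrow> 'a::euclidean_space" where
  "band_position q u v m \<epsilon> i = (case i of
     Va \<Rightarrow> q - u | Vb \<Rightarrow> q + u | Vc \<Rightarrow> q + v |
     Vd \<Rightarrow> q + \<epsilon> *\<^sub>R (- u + v + m) | Ve \<Rightarrow> q + \<epsilon> *\<^sub>R (- m) | Vf \<Rightarrow> q + \<epsilon> *\<^sub>R (u - v + 2 *\<^sub>R m))"

lemma realization_band_position:
  fixes q u v m :: "'a::euclidean_space"
  assumes indep: "\<And>x y. x *\<^sub>R u + y *\<^sub>R v = 0 \<Longrightarrow> x = 0 \<and> y = 0"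
    and m: "m \<noteq> 0" "m \<bullet> u = 0" "m \<bullet> v = 0" and \<epsilon>: "0 < \<epsilon>" "\<epsilon> \<le> 1 / 10"
  shows "realization (band_position q u v m \<epsilon>) band_faces"
proof
  show "\<tau> \<in> band_faces" if "\<sigma> \<in> band_faces" "\<tau> \<subseteq> \<sigma>" for \<sigma> \<tau>
    using band_faces_subface that .
  show "{i} \<in> band_faces" for i
    by (cases i) (simp_all add: band_faces_def band_triangles_def)
  show "w i = 0" if sum: "sum w UNIV = 0" "(\<Sum>i\<in>UNIV. w i *\<^sub>R band_position q u v m \<epsilon> i) = 0"
    and faces: "{i. 0 < w i} \<in> band_faces" "{i. w i < 0} \<in> band_faces" for w i
  proof -
    define A B C D E F where w: "A = w Va" "B = w Vb" "C = w Vc" "D = w Vd" "E = w Ve" "F = w Vf"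
    have sum0: "A + B + C + D + E + F = 0" using sum(1) by (simp add: sum_vtx w)
    have "0 = A *\<^sub>R (q - u) + B *\<^sub>R (q + u) + C *\<^sub>R (q + v) + D *\<^sub>R (q + \<epsilon> *\<^sub>R (- u + v + m)) +
        E *\<^sub>R (q + \<epsilon> *\<^sub>R (- m)) + F *\<^sub>R (q + \<epsilon> *\<^sub>R (u - v + 2 *\<^sub>R m))"
      using sum(2) by (simp add: sum_vtx w band_position_def)
    also have "\<dots> = (A + B + C + D + E + F) *\<^sub>R q + (B - A + \<epsilon> * (F - D)) *\<^sub>R u +
        (C - \<epsilon> * (F - D)) *\<^sub>R v + (\<epsilon> * (D - E + 2 * F)) *\<^sub>R m"
      by (simp add: algebra_simps)
    finally have eq: "(B - A + \<epsilon> * (F - D)) *\<^sub>R u + (C - \<epsilon> * (F - D)) *\<^sub>R v +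
        (\<epsilon> * (D - E + 2 * F)) *\<^sub>R m = 0"
      using sum0 by simp
    \<comment> \<open>\<open>m\<close> is orthogonal to \<open>u\<close> and \<open>v\<close>, so
      the inner product isolates its coefficient.\<close>
    from arg_cong[OF this, of "\<lambda>x. m \<bullet> x"] have DEF: "D - E + 2 * F = 0"
      using m \<epsilon> by (simp add: inner_add_right)
    then have "(B - A + \<epsilon> * (F - D)) *\<^sub>R u + (C - \<epsilon> * (F - D)) *\<^sub>R v = 0"
      using eq by simp
    from indep[OF this] have "B - A + C = 0" "C = \<epsilon> * (F - D)" by simp_all
    then show ?thesis
      using band_dependency_signs[OF _ _ _ _ \<epsilon> faces] DEF sum0 unfolding w by blast
  qed
qed

text \<open>At a point of \<open>S\<close> the weighted sum of the nonnegative excesses over \<beta>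
  is at most 0, so each term vanishes; a vertex with strict excess has weight 0.\<close>

lemma hull_Int_subset:
  assumes n: "\<And>x. x \<in> S \<Longrightarrow> n \<bullet> x \<le> \<beta>" "\<And>i. i \<in> outer \<Longrightarrow> \<beta> \<le> n \<bullet> p i"
    and strict: "\<And>i. i \<notin> outer \<Longrightarrow> \<beta> < n \<bullet> p i"
  shows "convex hull (p ` \<sigma>) \<inter> S \<subseteq> convex hull (p ` outer)"
proof clarify
  fix x assume "x \<in> convex hull (p ` \<sigma>)" "x \<in> S"
  then obtain w where w: "\<forall>i. 0 \<le> w i" "\<forall>i. i \<notin> \<sigma> \<longrightarrow> w i = 0" "sum w UNIV = 1"
      "(\<Sum>i\<in>UNIV. w i *\<^sub>R p i) = x"
    unfolding mem_convex_hull_image_iff by blast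
  have "n \<bullet> x = (\<Sum>i\<in>UNIV. w i * (n \<bullet> p i))"
    unfolding w(4)[symmetric] by (simp add: inner_sum_right)
  then have "(\<Sum>i\<in>UNIV. w i * (n \<bullet> p i - \<beta>)) = n \<bullet> x - \<beta>"
    using w(3) by (simp add: right_diff_distrib sum_subtractf flip: sum_distrib_right)
  also have "\<dots> \<le> 0" using n(1)[OF \<open>x \<in> S\<close>] by simp
  finally have "(\<Sum>i\<in>UNIV. w i * (n \<bullet> p i - \<beta>)) \<le> 0" .
  moreover have nonneg: "0 \<le> w i * (n \<bullet> p i - \<beta>)" for i
    using w(1) n(2)[of i] strict[of i] by (cases "i \<in> outer") auto
  ultimately have "(\<Sum>i\<in>UNIV. w i * (n \<bullet> p i - \<beta>)) = 0"
    by (intro order_antisym sum_nonneg)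
  then have "w i * (n \<bullet> p i - \<beta>) = 0" for i
    using nonneg by (simp add: sum_nonneg_eq_0_iff)
  then have "w i = 0" if "i \<notin> outer" for i
    using strict[OF that] by (metis diff_gt_0_iff_gt less_irrefl mult_eq_0_iff)
  then show "x \<in> convex hull (p ` outer)"
    unfolding mem_convex_hull_image_iff using w by blast
qed

section \<open>Choice of the triangle and of the scale\<close>

lemma boundary_triangle:
  fixes K :: "'a::euclidean_space set set"
  assumes "triangulated_surface K" "surface_boundary K \<noteq> {}"
  obtains a b c where "\<not> affine_dependent {a, b, c}" "a \<noteq> b" "b \<noteq> c" "a \<noteq> c"
    "convex hull {a, b, c} \<in> triangles K" "convex hull {a, b} \<in> K"
    "triangles_at K (convex hull {a, b}) = {convex hull {a, b, c}}"
proof -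
  have complex: "simplicial_complex K" using assms(1) by (simp add: triangulated_surface_def)
  obtain E where E: "E \<in> edges K" "card (triangles_at K E) = 1"
    using assms(2) unfolding surface_boundary_def by blast
  then obtain T where T: "triangles_at K E = {T}" by (auto simp: card_1_singleton_iff)
  then have TK: "T \<in> triangles K" "E \<subseteq> T" by (auto simp: triangles_at_def)
  then obtain V where V: "\<not> affine_dependent V" "card V = 3" "T = convex hull V"
    by (auto simp: triangles_def simplex_def)
  have "E face_of T"
    using complex E TK unfolding simplicial_complex_def edges_def triangles_def
    by (metis (no_types, lifting) Int_absorb1 mem_Collect_eq)
  then obtain W where W: "W \<subseteq> V" "E = convex hull W"
    unfolding V(3) face_of_convex_hull_affine_independent[OF V(1)] by blast
  have indep: "\<not> affine_dependent W" using affine_dependent_subset V(1) W(1) by blast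
  have "aff_dim E = 1" using E(1) aff_dim_simplex by (auto simp: edges_def)
  then have "card W = 2"
    using aff_dim_affine_independent[OF indep] unfolding W(2) aff_dim_convex_hull by simp
  then obtain a b where ab: "W = {a, b}" "a \<noteq> b" by (auto simp: card_2_iff)
  have "card (V - W) = 1"
    using V(2) \<open>card W = 2\<close> W(1) by (subst card_Diff_subset) (auto intro: card_ge_0_finite simp: ab)
  then obtain c where c: "V - W = {c}" by (auto simp: card_1_singleton_iff)
  then have "V = {a, b, c}" "c \<noteq> a" "c \<noteq> b" using W(1) ab by auto
  then show ?thesis
    using that[of a b c] V W ab T TK E(1) by (auto simp: edges_def)
qed

lemma band_patch_exists:
  fixes K :: "'a::euclidean_space set set"
  assumes surface: "triangulated_surface K" and boundary: "surface_boundary K \<noteq> {}"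
    and dim: "3 \<le> DIM('a)"
  shows "\<exists>p. band_patch p K"
proof -
  obtain a b c where abc: "\<not> affine_dependent {a, b, c}" "a \<noteq> b" "b \<noteq> c" "a \<noteq> c"
    and T: "convex hull {a, b, c} \<in> triangles K" and E: "convex hull {a, b} \<in> K"
    and at_E: "triangles_at K (convex hull {a, b}) = {convex hull {a, b, c}}"
    using boundary_triangle[OF surface boundary] .
  define T where "T = convex hull {a, b, c}"
  define q u v where "q = (1 / 2) *\<^sub>R (a + b)" and "u = (1 / 2) *\<^sub>R (b - a)" and "v = c - q"
  have abc_eq: "a = q - u" "b = q + u" "c = q + v"
    by (simp_all add: q_def u_def v_def algebra_simps flip: scaleR_add_left)
  have complex: "simplicial_complex K" using surface by (simp add: triangulated_surface_def)
  have TK: "T \<in> K" using T by (simp add: triangles_def T_def)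
  have indep: "x = 0 \<and> y = 0" if "x *\<^sub>R u + y *\<^sub>R v = 0" for x y
  proof -
    have "r *\<^sub>R a + s *\<^sub>R b + t *\<^sub>R c = (r + s + t) *\<^sub>R q + (s - r) *\<^sub>R u + t *\<^sub>R v" for r s t
      unfolding abc_eq by (simp add: algebra_simps)
    \<comment> \<open>Coefficients with sum 0 that yield \<open>x\<close> at \<open>u\<close> and
      \<open>y\<close> at \<open>v\<close>.\<close>
    from this[of "- (x + y) / 2" "(x - y) / 2" y]
    have "(- (x + y) / 2) *\<^sub>R a + ((x - y) / 2) *\<^sub>R b + y *\<^sub>R c = 0"
      using that by (simp add: field_simps)
    from affine_independent_3[OF abc _ this] show ?thesis by (simp add: field_simps)
  qed
  \<comment> \<open>The ambient dimension enters here: the band needs room off the plane of the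
    triangle.\<close>
  have "dim {u, v} < DIM('a)"
    using dim_le_card'[of "{u, v}"] card_insert_le_m1[of 2 "{v}" u] dim by simp
  then obtain m where m: "m \<noteq> 0" "m \<bullet> u = 0" "m \<bullet> v = 0"
    using orthogonal_to_subspace_exists[of "{u, v}"]
    by (metis insertCI orthogonal_def inner_commute span_base)
  define Q where "Q = {- u + v + m, - m, u - v + 2 *\<^sub>R m}"
  define separated where "separated S \<epsilon> \<longleftrightarrow> (\<exists>n \<beta>. (\<forall>x\<in>S. n \<bullet> x \<le> \<beta>) \<and> (\<forall>x\<in>T. \<beta> \<le> n \<bullet> x) \<and>
      (\<forall>y\<in>Q. \<beta> < n \<bullet> (q + \<epsilon> *\<^sub>R y)))" for S \<epsilon>
  \<comment> \<open>The edge \<open>ab\<close> contains \<open>q\<close> and cannot be strictly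
    separated from it; being part of \<open>T\<close>, it satisfies the condition
    \<open>near\<close> trivially.\<close>
  define far where "far = K - {T, convex hull {a, b}}"
  have "\<forall>\<^sub>F \<epsilon> in at_right 0. separated S \<epsilon>" if S: "S \<in> far" for S
  proof (cases "S = {}")
    case True
    have "separated S \<epsilon>" for \<epsilon>
      unfolding separated_def True by (rule exI[of _ 0], rule exI[of _ "-1"]) simp
    then show ?thesis by simp
  next
    case False
    have SK: "S \<in> K" "S \<noteq> T" "S \<noteq> convex hull {a, b}" using S by (auto simp: far_def)
    have poly: "polytope S" "polytope T"
      using complex SK(1) TK simplex_imp_polytope unfolding simplicial_complex_def by blast+
    have face: "(S \<inter> T) face_of T" "(S \<inter> T) face_of S"
      using complex SK(1) TK unfolding simplicial_complex_def by (metis Int_commute)+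
    have "q \<in> open_segment a b"
      using abc(2) midpoint_in_open_segment[of a b] by (simp add: midpoint_def q_def inverse_eq_divide)
    have abT: "a \<in> T" "b \<in> T" by (simp_all add: T_def hull_inc)
    have "q \<in> T"
      using \<open>q \<in> open_segment a b\<close> abT closed_segment_subset[of a T b] by (auto simp: T_def open_segment_def)
    \<comment> \<open>The boundary edge is used here. A simplex through \<open>q\<close> contains
      \<open>a\<close> and \<open>b\<close>, because its trace on \<open>T\<close> is a face. Any
      triangle around it then contains \<open>ab\<close>, so it is \<open>T\<close>, and the simplex
      is \<open>ab\<close> or \<open>T\<close>.\<close>
    have "q \<notin> S"
    proof
      assume "q \<in> S"
      then have ab: "a \<in> S" "b \<in> S"
        using face(1) abT \<open>q \<in> open_segment a b\<close> \<open>q \<in> T\<close> unfolding face_of_def by blast+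
      obtain T' where T': "T' \<in> triangles K" "S \<subseteq> T'"
        using surface SK(1) unfolding triangulated_surface_def by blast
      have "convex T'" using T'(1) convex_simplex by (auto simp: triangles_def)
      then have "convex hull {a, b} \<subseteq> T'"
        using ab T'(2) by (intro hull_minimal) auto
      then have "T' = T" using T'(1) at_E unfolding triangles_at_def T_def by blast
      then have "S face_of T" using T'(2) face(1) by (simp add: Int_absorb2)
      then obtain W where W: "W \<subseteq> {a, b, c}" "S = convex hull W"
        unfolding T_def face_of_convex_hull_affine_independent[OF abc(1)] by blast
      have ext: "x \<in> W" if "x \<in> {a, b, c}" "x \<in> S" for x
      proof -
        have "x extreme_point_of T"
          unfolding T_def using extreme_point_of_convex_hull_affine_independent[OF abc(1)] that(1) by blast
        then have "x extreme_point_of S"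
          using \<open>S face_of T\<close> that(2) extreme_point_of_face by blast
        then show ?thesis unfolding W(2) by (rule extreme_point_of_convex_hull)
      qed
      have "W = {a, b} \<or> W = {a, b, c}" using W(1) ext ab by blast
      then show False using W(2) SK(2,3) by (auto simp: T_def)
    qed
    obtain n \<beta> where n: "\<And>x. x \<in> S \<Longrightarrow> n \<bullet> x \<le> \<beta>" "\<And>x. x \<in> T \<Longrightarrow> \<beta> \<le> n \<bullet> x" "\<beta> < n \<bullet> q"
      using separating_hyperplane_polytopes[OF poly False \<open>q \<in> T\<close> face(1) \<open>q \<notin> S\<close>] by metis
    \<comment> \<open>The inequality is strict at \<open>q\<close>, so it persists for small
      \<epsilon>; finitely many simplices and three directions allow a common choice.\<close>
    have "\<forall>\<^sub>F \<epsilon> in at_right 0. \<beta> < n \<bullet> (q + \<epsilon> *\<^sub>R y)" for y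
    proof -
      have "((\<lambda>\<epsilon>. n \<bullet> (q + \<epsilon> *\<^sub>R y)) \<longlongrightarrow> n \<bullet> (q + 0 *\<^sub>R y)) (at_right 0)"
        by (intro tendsto_intros)
      then show ?thesis using n(3) by (intro order_tendstoD(1)) auto
    qed
    then have "\<forall>\<^sub>F \<epsilon> in at_right 0. \<forall>y\<in>Q. \<beta> < n \<bullet> (q + \<epsilon> *\<^sub>R y)"
      by (intro eventually_ball_finite) (auto simp: Q_def)
    then show ?thesis
      by (rule eventually_mono) (use n separated_def in blast)
  qed
  then have "\<forall>\<^sub>F \<epsilon> in at_right 0. \<forall>S\<in>far. separated S \<epsilon>"
    using complex by (intro eventually_ball_finite) (auto simp: far_def simplicial_complex_def)
  moreover have "\<forall>\<^sub>F \<epsilon> :: real in at_right 0. 0 < \<epsilon> \<and> \<epsilon> \<le> 1 / 10"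
    by (auto intro!: eventually_at_rightI[of 0 "1/10"])
  ultimately have "\<forall>\<^sub>F \<epsilon> in at_right 0. (\<forall>S\<in>far. separated S \<epsilon>) \<and> 0 < \<epsilon> \<and> \<epsilon> \<le> 1 / 10"
    by (rule eventually_conj)
  then obtain \<epsilon> where sep: "\<And>S. S \<in> far \<Longrightarrow> separated S \<epsilon>" and \<epsilon>: "0 < \<epsilon>" "\<epsilon> \<le> 1 / 10"
    using eventually_happens'[OF trivial_limit_at_right_real] by blast
  define p where "p = band_position q u v m \<epsilon>"
  interpret realization p band_faces
    unfolding p_def by (rule realization_band_position[OF indep m \<epsilon>])
  have p_outer: "p ` outer = {a, b, c}"
    by (simp add: p_def band_position_def outer_def abc_eq)
  then have cell_outer: "cell outer = T" by (simp add: cell_def T_def)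
  have inner: "\<exists>y\<in>Q. p i = q + \<epsilon> *\<^sub>R y" if "i \<notin> outer" for i
    using that by (cases i) (simp_all add: outer_def p_def band_position_def Q_def)
  have "band_patch p K"
  proof
    show "triangulated_surface K" by (rule surface)
    show "cell outer \<in> triangles K" using T by (simp add: cell_outer T_def)
    show "cell \<sigma> \<inter> S \<subseteq> cell outer" if S: "S \<in> K" "S \<noteq> cell outer" and "\<sigma> \<in> band_faces" for S \<sigma>
    proof (cases "S = convex hull {a, b}")
      case True
      then have "S \<subseteq> cell outer" by (simp add: cell_outer T_def hull_mono)
      then show ?thesis by blast
    next
      case False
      then obtain n \<beta> where n: "\<forall>x\<in>S. n \<bullet> x \<le> \<beta>" "\<forall>x\<in>T. \<beta> \<le> n \<bullet> x" "\<forall>y\<in>Q. \<beta> < n \<bullet> (q + \<epsilon> *\<^sub>R y)"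
        using sep[of S] S by (auto simp: far_def cell_outer separated_def)
      show ?thesis
        unfolding cell_def
      proof (rule hull_Int_subset)
        show "\<beta> \<le> n \<bullet> p i" if "i \<in> outer" for i
          using n(2) vertex_in_cell[OF that] cell_outer by blast
        show "\<beta> < n \<bullet> p i" if "i \<notin> outer" for i
          using n(3) inner[OF that] by metis
      qed (use n in blast)
    qed
    show "p i \<notin> \<Union>K" if i: "i \<notin> outer" for i
    proof
      assume "p i \<in> \<Union>K"
      then obtain S where S: "S \<in> K" "p i \<in> S" by blast
      \<comment> \<open>Height along \<open>m\<close> keeps the new vertices off \<open>T\<close>
        and \<open>ab\<close>; the strict side of the hyperplanes keeps them off all other
        simplices.\<close>
      have "T \<subseteq> {x. m \<bullet> x = m \<bullet> q}"
        unfolding T_def using m by (intro hull_minimal) (auto simp: abc_eq inner_simps convex_hyperplane)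
      moreover have "m \<bullet> p i \<noteq> m \<bullet> q"
        using i m \<epsilon> by (cases i) (simp_all add: outer_def p_def band_position_def inner_simps)
      ultimately have "p i \<notin> T" by blast
      then have "S \<noteq> T" "S \<noteq> convex hull {a, b}"
        using S(2) hull_mono[of "{a, b}" "{a, b, c}" convex] by (auto simp: T_def)
      then obtain n \<beta> where "\<forall>x\<in>S. n \<bullet> x \<le> \<beta>" "\<forall>y\<in>Q. \<beta> < n \<bullet> (q + \<epsilon> *\<^sub>R y)"
        using sep[of S] S by (auto simp: far_def separated_def)
      then show False using inner[OF i] S(2) by fastforce
    qed
  qed
  then show ?thesis by blast
qed

section \<open>Comparison of genus and crosscap number\<close>

theorem proposition2:
  fixes L :: "(real^3) set" and n :: nat
  assumes "is_link n L"
  shows "crosscap_number L \<le> 2 * orientable_genus L + 1"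
proof -
  define G where "G = {g. \<exists>h K. spanning_surface L h K \<and> orientable K \<and>
    euler_char K = 2 - 2 * int g - int (card (components L))}"
  show ?thesis
  proof (cases "G = {}")
    case True
    \<comment> \<open>The infimum of the empty set makes the right-hand side infinite.\<close>
    then have "orientable_genus L = \<infinity>"
      unfolding orientable_genus_def G_def[symmetric] by (simp add: top_enat_def)
    then show ?thesis by (simp add: numeral_eq_enat)
  next
    case False
    then have "Inf (enat ` G) \<in> enat ` G"
      unfolding Inf_enat_def by (auto intro: LeastI)
    then obtain g where g: "g \<in> G" "orientable_genus L = enat g"
      unfolding orientable_genus_def G_def[symmetric] by auto
    then obtain h K where K: "spanning_surface L h K"
      and euler: "euler_char K = 2 - 2 * int g - int (card (components L))"
      unfolding G_def by blast
    have "L \<noteq> {}" using assms by (auto simp: is_link_def)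
    then have "surface_boundary K \<noteq> {}" using K by (auto simp: spanning_surface_def)
    then obtain p where "band_patch p K"
      using K band_patch_exists[of K] by (auto simp: spanning_surface_def)
    then interpret band_patch p K .
    have "spanning_surface L h patched"
      using K triangulated_surface_patched connected_patched surface_boundary_patched
      unfolding spanning_surface_def by simp
    \<comment> \<open>The drop of the Euler characteristic by one is the summand 1 in the
      bound.\<close>
    moreover have "int (2 * g + 1) = 2 - euler_char patched - int (card (components L))"
      using euler euler_char_patched by simp
    ultimately have "crosscap_number L \<le> enat (2 * g + 1)"
      unfolding crosscap_number_def using not_orientable_patched by (intro INF_lower) blast
    also have "\<dots> = 2 * orientable_genus L + 1"
      unfolding g(2) by (simp add: numeral_eq_enat one_enat_def)
    finally show ?thesis .
  qed
qed

end
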